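(* Assume the two-layer linear setting below together with Assumptions (A1) and (A2), that $\lambda_1=c_1 n$ for a constant $c_1>0$ with $\eta c_1<1$, and that $\lambda_r>0$. Then for every $\epsilon>0$ there exist constants $C_1,C_2,C_3>0$, depending only on $\chi$, $c_1$ and $\eta c_1$, such that the following holds. Suppose $$m\ge C_1\frac{n^2}{\lambda_r^2}\quad\text{and}\quad n\ge C_2\max\Big\{\frac{\lambda_r}{\kappa^2},\frac{\lambda_r^2}{\kappa^2},\frac{\lambda_r^2}{\kappa^4\epsilon^2},\frac{\lambda_r^4}{\kappa^4\epsilon^2}\Big\}.$$ Let $t_0$ be the first iteration at which either $\|D(t)\|^2\le C_3\epsilon^2$ or $\lambda_{\max}(M^*(t))>1/\eta$. Then for all $t=1,2,\dots,t_0-1$: (i) $\Lambda^*(t+1)-\Lambda^*(t)>0$; and (ii) $\|\Gamma(t)\|\le 40/m$.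
   Context: Two-layer linear setting. Let $m$ be even and let $d,n\ge1$. The data matrix is $X=[x_1,\dots,x_n]\in\mathbb R^{d\times n}$ and the labels are $Y=(y_1,\dots,y_n)^\top\in\{-1,1\}^n$, so that $\|Y\|=\sqrt n$. Assume there exist $A^*\in\mathbb R^m$ and $W^*\in\mathbb R^{m\times d}$ with $Y^\top=A^{*\top}W^*X$. The network is $f(x)=\frac1{\sqrt m}A^\top Wx$ with $A\in\mathbb R^m$ and $W\in\mathbb R^{m\times d}$, whose rows are denoted $w_q^\top$. Define the output vector $F=\frac1{\sqrt m}X^\top W^\top A\in\mathbb R^n$, the residual $D=F-Y$, and the loss $\mathcal L=\frac1n\|D\|^2$. Gradient descent with step size $\eta>0$ is $$A(t+1)=A(t)-\tfrac{2\eta}{n\sqrt m}W(t)XD(t),\qquad W(t+1)=W(t)-\tfrac{2\eta}{n\sqrt m}A(t)D(t)^\top X^\top.$$ The initialization is symmetric: $a_q(0)\in\{-1,1\}$ and $a_{q+m/2}(0)=-a_q(0)$, $w_{q+m/2}(0)=w_q(0)$ for $q\le m/2$, and $\sum_{q\le m/2}w_q(0)w_q(0)^\top=\frac{m}{2d}I_d$. Consequently $F(0)=0$, $\|A(0)\|^2=m$ and $W(0)^\top W(0)=\frac md I_d$. Define the following matrices: - the Gram matrix $M(t)=\frac{2}{mn}\big(\|A(t)\|^2X^\top X+X^\top W(t)^\top W(t)X\big)$; - $M^*(t)=M(t)-\frac{4\eta}{n^2m}(D(t)^\top F(t))X^\top X$; - $\Gamma(t)=\frac{2}{mn}\big(X^\top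 W(t)^\top W(t)X-\frac md X^\top X\big)$; - $\tilde M(t)=M^*(t)-\Gamma(t)$, which equals $\frac{2}{mn}\big(\|A(t)\|^2+\frac md-\frac{2\eta}{n}D(t)^\top F(t)\big)X^\top X$. $X^\top X$ has rank $r$ and eigendecomposition $\sum_{i=1}^r\lambda_iv_iv_i^\top$, with orthonormal $v_i$ and $\lambda_1\ge\dots\ge\lambda_r>0$. Set $z_i=Y^\top v_i$. For a matrix of the form $\gamma X^\top X$, write $\lambda_i(\cdot):=v_i^\top(\cdot)v_i=\gamma\lambda_i$. Define $\Lambda^*(t)=v_1^\top M(t)v_1$. All norms are Euclidean or spectral. (A1): there is a constant $\chi>1$ with $\lambda_i\le\chi\lambda_{i+1}$ for all $i\in[r-1]$, and moreover $\lambda_1\ge2\lambda_2$. (A2): there is $\kappa>0$ with $z_i/\sqrt n\ge\kappa$ for all $i\in[r]$. *)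

theory Defs
  imports "Jordan_Normal_Form.Char_Poly"
begin

text \<open>Matrices and vectors are Jordan_Normal_Form matrices/vectors with explicit dimensions.
  X : d x n (columns are data points), Y : n-vector, A : m-vector, W : m x d matrix.\<close>

definition vnorm :: "real vec \<Rightarrow> real" where
  "vnorm v = sqrt (v \<bullet> v)"

definition spec_norm :: "real mat \<Rightarrow> real" where
  "spec_norm B = Sup {vnorm (B *\<^sub>v x) | x. x \<in> carrier_vec (dim_col B) \<and> vnorm x = 1}"

definition lambda_max :: "real mat \<Rightarrow> real" where
  "lambda_max B = Max {k. eigenvalue B k}"

definition outer :: "real vec \<Rightarrow> real vec \<Rightarrow> real mat" where
  "outer u w = mat (dim_vec u) (dim_vec w) (\<lambda>(i,j). u $ i * w $ j)"

definition net_F :: "real mat \<Rightarrow> real vec \<Rightarrow> real mat \<Rightarrow> real vec" where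
  "net_F X A W = (1 / sqrt (real (dim_vec A))) \<cdot>\<^sub>v ((transpose_mat X * transpose_mat W) *\<^sub>v A)"

definition resid :: "real mat \<Rightarrow> real vec \<Rightarrow> real vec \<Rightarrow> real mat \<Rightarrow> real vec" where
  "resid X Y A W = net_F X A W - Y"

primrec gd :: "real \<Rightarrow> real mat \<Rightarrow> real vec \<Rightarrow> real vec \<Rightarrow> real mat \<Rightarrow> nat \<Rightarrow> real vec \<times> real mat" where
  "gd eta X Y A0 W0 0 = (A0, W0)"
| "gd eta X Y A0 W0 (Suc t) =
     (let (A, W) = gd eta X Y A0 W0 t;
          n = real (dim_col X); m = real (dim_vec A);
          c = 2 * eta / (n * sqrt m);
          D = resid X Y A W
      in (A - c \<cdot>\<^sub>v ((W * X) *\<^sub>v D), W - c \<cdot>\<^sub>m outer A (X *\<^sub>v D)))"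

definition gram_M :: "real mat \<Rightarrow> real vec \<Rightarrow> real mat \<Rightarrow> real mat" where
  "gram_M X A W = (let n = real (dim_col X); m = real (dim_vec A) in
     (2 / (m * n)) \<cdot>\<^sub>m ((A \<bullet> A) \<cdot>\<^sub>m (transpose_mat X * X)
        + transpose_mat X * transpose_mat W * W * X))"

definition gram_Mstar :: "real \<Rightarrow> real mat \<Rightarrow> real vec \<Rightarrow> real vec \<Rightarrow> real mat \<Rightarrow> real mat" where
  "gram_Mstar eta X Y A W = (let n = real (dim_col X); m = real (dim_vec A) in
     gram_M X A W - (4 * eta / (n^2 * m) * (resid X Y A W \<bullet> net_F X A W)) \<cdot>\<^sub>m (transpose_mat X * X))"

definition gram_Gamma :: "real mat \<Rightarrow> real vec \<Rightarrow> real mat \<Rightarrow> real mat" where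
  "gram_Gamma X A W = (let n = real (dim_col X); m = real (dim_vec A); d = real (dim_row X) in
     (2 / (m * n)) \<cdot>\<^sub>m (transpose_mat X * transpose_mat W * W * X
        - (m / d) \<cdot>\<^sub>m (transpose_mat X * X)))"

end

theory Submission
  imports Defs "HOL-Analysis.L2_Norm"
begin

text \<open>In the eigenbasis \<open>v\<^sub>i\<close> of \<open>X\<^sup>T X\<close> the residual obeys
  \<open>D(t+1) = (I - \<eta> \<gamma>(t) X\<^sup>T X) D(t) - \<eta> \<Gamma>(t) D(t)\<close>. Dropping \<open>\<Gamma>\<close> gives a diagonal reference
  trajectory whose coordinates are \<open>- z\<^sub>i\<close> times a product of factors in \<open>[0,1)\<close>. Along it the increments of
  \<open>\<Gamma>\<close> are dominated entrywise by telescoping sums, so \<open>\<Gamma>\<close> is of order \<open>1/m\<close>; the deviation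
  from the reference trajectory is then summable, with total size controlled by \<open>m \<ge> C\<^sub>1 n\<^sup>2/\<lambda>\<^sub>r\<^sup>2\<close>.
  Both facts are proved in one induction, together with \<open>D\<^sup>T F \<le> 0\<close>, which keeps \<open>\<parallel>A\<parallel>\<^sup>2 \<ge> m\<close> and hence
  \<open>\<gamma>\<close> bounded below. On the reference trajectory \<open>- D\<^sup>T F = \<Sum> z\<^sub>i\<^sup>2 \<pi>\<^sub>i (1 - \<pi>\<^sub>i)\<close> with \<open>\<pi>\<^sub>i\<close> the
  decay factor; this stays above the deviation because the ratios of consecutive eigenvalues are
  bounded and the residual has not yet become small. The sign of \<open>D\<^sup>T F + D\<^sub>1 F\<^sub>1\<close> is the sign of
  \<open>\<Lambda>\<^sup>*(t) - \<Lambda>\<^sup>*(t+1)\<close> up to terms of favourable sign.\<close>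

text \<open>The estimates depend on each other: \<open>\<gamma>\<close> is read off the true
  trajectory, the deviation is small only while \<open>\<Gamma>\<close> is, and
  \<open>\<Gamma>\<close> is controlled only while \<open>D\<^sup>T F \<le> 0\<close>. The loop
  closes by scales. Put \<mu> = \<eta>/m and l_i = \<eta> \<lambda>_i / n. The reference residuals
  contract at rate at least l_r, so their norms sum to at most sqrt n / l_r; each step perturbs them
  by a relative O(\<mu>), so all perturbations together are O(\<mu> sqrt n / l_r). The width
  condition, in the form K \<mu> \<le> l_r^2, turns this into O(l_r sqrt n / K). Hence the alignment
  along the reference trajectory only has to exceed a multiple of l_r n / K, and this is what the
  lower bound on n supplies. The stopping rule bounds the largest eigenvalue of the full matrix
  including \<open>\<Gamma>\<close>, so the factor for the top eigenvalue may be negative by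
  O(\<mu>). Reference factors are therefore truncated at 0 and the excess is charged to the
  deviation. The telescoping works because each increment of \<open>\<Gamma>\<close> contains a
  factor l_i D_i, and on the reference trajectory l_i |D_i| is at most z_i times the drop of the
  decay factor in that very step.\<close>

section \<open>Elementary inequalities for Euclidean norms of finite families\<close>

lemma L2_set_cmult_le:
  assumes "finite A" "0 \<le> c" "\<And>i. i \<in> A \<Longrightarrow> \<bar>f i\<bar> \<le> c * \<bar>g i\<bar>"
  shows "L2_set f A \<le> c * L2_set g A"
proof -
  have "L2_set f A = L2_set (\<lambda>i. \<bar>f i\<bar>) A" by (simp add: L2_set_def)
  also have "\<dots> \<le> L2_set (\<lambda>i. c * \<bar>g i\<bar>) A"
    by (intro L2_set_mono) (use assms in auto)
  also have "\<dots> = c * L2_set (\<lambda>i. \<bar>g i\<bar>) A" using assms(2) by (rule L2_set_right_distrib[symmetric])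
  also have "\<dots> = c * L2_set g A" by (simp add: L2_set_def)
  finally show ?thesis .
qed

lemma abs_sum_mult_le_L2_set: "\<bar>\<Sum>i\<in>A. f i * g i\<bar> \<le> L2_set f A * L2_set g A"
proof -
  have "\<bar>\<Sum>i\<in>A. f i * g i\<bar> \<le> (\<Sum>i\<in>A. \<bar>f i\<bar> * \<bar>g i\<bar>)"
    by (rule order_trans[OF sum_abs]) (simp add: abs_mult)
  then show ?thesis using L2_set_mult_ineq order_trans by blast
qed

text \<open>Turns bounds on a bilinear form into bounds on a vector: the vector itself serves as
  test vector and one factor of its norm cancels.\<close>

lemma L2_set_le_of_self_pairing:
  assumes "(\<Sum>i\<in>A. f i * f i) \<le> c * L2_set f A" "0 \<le> c"
  shows "L2_set f A \<le> c"
proof -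
  have nn: "0 \<le> (\<Sum>i\<in>A. f i * f i)" by (intro sum_nonneg) auto
  have "L2_set f A * L2_set f A = (\<Sum>i\<in>A. f i * f i)"
    using nn by (simp add: L2_set_def power2_eq_square)
  with assms have "L2_set f A * L2_set f A \<le> c * L2_set f A" by simp
  then show ?thesis using assms(2) L2_set_nonneg[of f A]
    by (cases "L2_set f A = 0") (auto simp: mult_le_cancel_right)
qed

section \<open>The dynamics in eigencoordinates, free of matrices\<close>

text \<open>Intended reading: \<open>l i\<close> is \<open>\<eta> \<lambda>\<^sub>i / n\<close>,
  \<open>\<mu>\<close> is \<open>\<eta> / m\<close>, \<open>H\<close> is
  \<open>\<eta> \<Gamma>\<close> in the eigenbasis, \<open>b\<close> is
  \<open>\<parallel>A\<parallel>\<^sup>2 / m\<close>, and \<open>g * l i\<close> is the i-th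
  eigenvalue of \<open>\<eta>\<close> times \<open>M\<^sup>* - \<Gamma>\<close>. The assumption
  \<open>K * \<mu> \<le> (l r)\<^sup>2\<close> is the width condition, \<open>sharp\<close> and
  \<open>D_big\<close> say that the stopping rule has not fired up to \<open>T\<close>, and
  \<open>small1\<close> to \<open>small4\<close> are the requirements on \<open>n\<close>, one for
  each place where a lower bound has to beat the deviation.\<close>

locale gd_coords =
  fixes r :: nat and l z :: "nat \<Rightarrow> real" and D :: "nat \<Rightarrow> nat \<Rightarrow> real"
    and H :: "nat \<Rightarrow> nat \<Rightarrow> nat \<Rightarrow> real" and b g :: "nat \<Rightarrow> real"
    and n \<mu> K \<chi> \<zeta> \<delta> w :: real and T :: nat
  assumes r: "1 \<le> r" and n: "0 < n" and mu: "0 < \<mu>"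
    and K: "7680 \<le> K" "40 \<le> K * (1 - l 1)" "K * \<mu> \<le> (l r)\<^sup>2"
    and l_pos: "\<And>i. i \<in> {1..r} \<Longrightarrow> 0 < l i"
    and l_le: "\<And>i. i \<in> {1..r} \<Longrightarrow> l i \<le> l 1"
    and l_ge: "\<And>i. i \<in> {1..r} \<Longrightarrow> l r \<le> l i"
    and l1: "l 1 < 1"
    and chain: "\<And>i. i \<in> {1..<r} \<Longrightarrow> l i \<le> \<chi> * l (i + 1)" and chi: "1 < \<chi>"
    and z_ge: "\<And>i. i \<in> {1..r} \<Longrightarrow> \<zeta> \<le> z i" and zeta: "0 < \<zeta>"
    and z_sum: "(\<Sum>i\<in>{1..r}. (z i)\<^sup>2) = n"
    and w: "w = 4 * \<mu> / n"
    and D0: "\<And>i. i \<in> {1..r} \<Longrightarrow> D 0 i = - z i"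
    and H0: "\<And>i j. i \<in> {1..r} \<Longrightarrow> j \<in> {1..r} \<Longrightarrow> H 0 i j = 0" and b0: "b 0 = 1"
    and D_Suc: "\<And>t i. i \<in> {1..r} \<Longrightarrow>
        D (Suc t) i = (1 - g t * l i) * D t i - (\<Sum>j\<in>{1..r}. H t i j * D t j)"
    and H_Suc: "\<And>t i j. i \<in> {1..r} \<Longrightarrow> j \<in> {1..r} \<Longrightarrow>
        H (Suc t) i j = H t i j - w * ((D t i + z i) * (l j * D t j) + (l i * D t i) * (D t j + z j))
          + 2 * w * b t * (l i * D t i) * (l j * D t j)"
    and b_Suc: "\<And>t. b t - w * (\<Sum>i\<in>{1..r}. (D t i + z i) * D t i) \<le> b (Suc t)"
    and g_ge: "\<And>t. 2 * b t - w * (\<Sum>i\<in>{1..r}. (D t i + z i) * D t i) \<le> g t"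
    and sharp: "\<And>t. t \<le> T \<Longrightarrow> g t * l 1 + H t 1 1 \<le> 1"
    and D_big: "\<And>t. t \<le> T \<Longrightarrow> \<delta> \<le> L2_set (D t) {1..r}" and delta: "0 < \<delta>"
    and small1: "480 * l r * n / K < \<zeta>\<^sup>2 / 2 * l 1"
    and small2: "480 * l r * n / K < \<zeta>\<^sup>2 / (4 * \<chi>)"
    and small3: "80 * l r * sqrt n / K \<le> \<delta> / 2"
    and small4: "480 * l r * n / K < \<zeta> * \<delta> / 4"
begin

declare One_nat_def [simp del]

abbreviation nrm :: "(nat \<Rightarrow> real) \<Rightarrow> real" where "nrm x \<equiv> L2_set x {1..r}"
abbreviation ip :: "(nat \<Rightarrow> real) \<Rightarrow> (nat \<Rightarrow> real) \<Rightarrow> real" where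
  "ip x y \<equiv> \<Sum>i\<in>{1..r}. x i * y i"

text \<open>The truncation at 0 keeps the product nonnegative, hence keeps the sign of every
  reference coordinate, although \<open>g s * l i\<close> may exceed 1 by a multiple of
  \<open>\<mu>\<close>.\<close>

definition decay :: "nat \<Rightarrow> nat \<Rightarrow> real" where
  "decay t i = (\<Prod>s<t. max 0 (1 - g s * l i))"
definition Dref :: "nat \<Rightarrow> nat \<Rightarrow> real" where "Dref t i = - (z i * decay t i)"
definition E :: "nat \<Rightarrow> nat \<Rightarrow> real" where "E t i = D t i - Dref t i"
definition F :: "nat \<Rightarrow> nat \<Rightarrow> real" where "F t i = D t i + z i"
definition S :: "nat \<Rightarrow> real" where "S t = (\<Sum>s<t. nrm (E s))"
text \<open>\<open>Q\<close> majorizes the pairing of a test vector with any vector dominated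
  coordinatewise by \<open>z\<close>. \<open>P t\<close> weights it by the progress made so far; it
  is the telescoped sum that dominates the pairings with \<open>l i * Dref s i\<close> over
  \<open>s < t\<close>.\<close>

definition Q :: "(nat \<Rightarrow> real) \<Rightarrow> real" where "Q x = (\<Sum>i\<in>{1..r}. z i * \<bar>x i\<bar>)"
definition P :: "nat \<Rightarrow> (nat \<Rightarrow> real) \<Rightarrow> real" where
  "P t x = (\<Sum>i\<in>{1..r}. (1 - decay t i) * (z i * \<bar>x i\<bar>))"
definition bil :: "nat \<Rightarrow> (nat \<Rightarrow> real) \<Rightarrow> (nat \<Rightarrow> real) \<Rightarrow> real" where
  "bil t y x = (\<Sum>i\<in>{1..r}. y i * (\<Sum>j\<in>{1..r}. H t i j * x j))"

lemma one_mem: "1 \<in> {1..r}" and r_mem: "r \<in> {1..r}" using r by auto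

lemma q: "0 < l r" "l r \<le> l 1" "l r < 1"
  using l_pos[OF r_mem] l_le[OF r_mem] l1 by auto

lemma w_pos: "0 < w" using w mu n by simp

text \<open>The first bound lets contraction absorb the feedback of the deviation on itself, the
  second keeps a slightly negative factor \<open>1 - g t * l i\<close> above
  \<open>-(1 - l r)\<close>, and the third gives \<open>b t * l i \<le> 1\<close>.\<close>

lemma mu_le: "80 * \<mu> \<le> l r" "40 * \<mu> \<le> 1 - l r" "40 * \<mu> \<le> 1"
proof -
  have q2: "(l r)\<^sup>2 \<le> l r" using q by (simp add: power2_eq_square mult_le_cancel_left1)
  have "7680 * \<mu> \<le> K * \<mu>" using K mu by (simp add: mult_right_mono)
  then show "80 * \<mu> \<le> l r" using K q2 mu by linarith
  have "40 * \<mu> \<le> K * (1 - l 1) * \<mu>" using K mu by (intro mult_right_mono) auto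
  also have "\<dots> = (K * \<mu>) * (1 - l 1)" by simp
  also have "\<dots> \<le> 1 * (1 - l 1)" using K q2 q l1 by (intro mult_right_mono) auto
  also have "\<dots> \<le> 1 - l r" using q by simp
  finally show "40 * \<mu> \<le> 1 - l r" .
  then show "40 * \<mu> \<le> 1" using q by linarith
qed

lemma z_pos: "i \<in> {1..r} \<Longrightarrow> 0 < z i" using z_ge zeta by fastforce

lemma nrm_z: "nrm z = sqrt n" by (simp add: L2_set_def z_sum)

lemma decay_nonneg: "0 \<le> decay t i" by (simp add: decay_def prod_nonneg)

lemma decay_Suc: "decay (Suc t) i = decay t i * max 0 (1 - g t * l i)"
  by (simp add: decay_def)

lemma decay_0: "decay 0 i = 1" by (simp add: decay_def)

lemma Q_le: "Q x \<le> sqrt n * nrm x" and Q_nonneg: "0 \<le> Q x"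
proof -
  have "Q x \<le> \<bar>\<Sum>i\<in>{1..r}. z i * \<bar>x i\<bar>\<bar>" by (simp add: Q_def)
  also have "\<dots> \<le> nrm z * nrm (\<lambda>i. \<bar>x i\<bar>)" by (rule abs_sum_mult_le_L2_set)
  also have "\<dots> = sqrt n * nrm x" unfolding nrm_z by (simp add: L2_set_def)
  finally show "Q x \<le> sqrt n * nrm x" .
  show "0 \<le> Q x" unfolding Q_def by (intro sum_nonneg) (use z_pos in \<open>auto simp: less_imp_le\<close>)
qed

text \<open>The increment of \<open>H\<close> is a combination of rank-one matrices, so on a pair of
  test vectors it splits into products of inner products that can be estimated one by one.\<close>

lemma bil_Suc: "bil (Suc t) y x = bil t y x
   - w * (ip (F t) y * ip (\<lambda>i. l i * D t i) x + ip (\<lambda>i. l i * D t i) y * ip (F t) x)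
   + 2 * w * (b t * ip (\<lambda>i. l i * D t i) y) * ip (\<lambda>i. l i * D t i) x"
proof -
  have "bil (Suc t) y x = (\<Sum>i\<in>{1..r}. \<Sum>j\<in>{1..r}. y i * (H (Suc t) i j * x j))"
    by (simp add: bil_def sum_distrib_left)
  also have "\<dots> = (\<Sum>i\<in>{1..r}. \<Sum>j\<in>{1..r}. y i * (H t i j * x j)
      - w * ((F t i * y i) * (l j * D t j * x j)) - w * ((l i * D t i * y i) * (F t j * x j))
      + 2 * w * b t * ((l i * D t i * y i) * (l j * D t j * x j)))"
    by (intro sum.cong refl) (simp add: H_Suc F_def algebra_simps)
  also have "\<dots> = (\<Sum>i\<in>{1..r}. \<Sum>j\<in>{1..r}. y i * (H t i j * x j))
      - w * (\<Sum>i\<in>{1..r}. \<Sum>j\<in>{1..r}. (F t i * y i) * (l j * D t j * x j))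
      - w * (\<Sum>i\<in>{1..r}. \<Sum>j\<in>{1..r}. (l i * D t i * y i) * (F t j * x j))
      + 2 * w * b t * (\<Sum>i\<in>{1..r}. \<Sum>j\<in>{1..r}. (l i * D t i * y i) * (l j * D t j * x j))"
    by (simp add: sum.distrib sum_subtractf sum_distrib_left)
  also have "(\<Sum>i\<in>{1..r}. \<Sum>j\<in>{1..r}. y i * (H t i j * x j)) = bil t y x"
    by (simp add: bil_def sum_distrib_left)
  finally show ?thesis unfolding sum_product[symmetric] by (simp only: algebra_simps)
qed

section \<open>The joint invariant and its immediate consequences\<close>

text \<open>The third and fourth conjuncts feed the lower bound on the alignment; the fourth starts
  at \<open>t = 1\<close> since \<open>decay 0 i = 1\<close>. The two norm conjuncts are contraction
  inequalities summed over time, so no geometric series has to be evaluated. The last conjunct keeps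
  \<open>P t\<close> instead of a constant because only this telescoping form reproduces itself; its
  three products belong to the two cross terms and the quadratic term in the update of
  \<open>H\<close>.\<close>

definition Inv :: "nat \<Rightarrow> bool" where
  "Inv t \<longleftrightarrow> 1 \<le> b t
    \<and> (\<forall>i\<in>{1..r}. decay t i \<le> 1)
    \<and> (\<forall>i\<in>{1..<r}. (1 - decay t i) / \<chi> \<le> 1 - decay t (i + 1))
    \<and> (t \<ge> 1 \<longrightarrow> l 1 \<le> 1 - decay t 1)
    \<and> nrm (Dref t) + l r * (\<Sum>s<t. nrm (Dref s)) \<le> sqrt n
    \<and> nrm (E t) + l r * S t \<le> 80 * \<mu> * (\<Sum>s<t. nrm (Dref s)) + 40 * \<mu> * S t
    \<and> (\<forall>x y. \<bar>bil t y x\<bar> \<le> w * (Q y * P t x + Q x * P t y + 2 * (Q y * P t x))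
          + 12 * w * sqrt n * S t * (nrm y * nrm x))"

lemma Inv_0: "Inv 0"
proof -
  have [simp]: "nrm (Dref 0) = sqrt n"
    using nrm_z by (simp add: L2_set_def Dref_def decay_0)
  have [simp]: "nrm (E 0) = 0" by (simp add: L2_set_def E_def Dref_def decay_0 D0)
  have [simp]: "bil 0 y x = 0" for y x
    unfolding bil_def by (intro sum.neutral ballI) (simp add: H0)
  show ?thesis using b0
    by (simp add: Inv_def decay_0 S_def P_def)
qed

lemma S_nonneg: "0 \<le> S t" by (simp add: S_def sum_nonneg L2_set_nonneg)

text \<open>Half of \<open>l r * S t\<close> absorbs \<open>40 * \<mu> * S t\<close>. The remaining
  forcing is \<open>80 * \<mu>\<close> times a sum of reference norms, which is at most
  \<open>sqrt n / l r\<close>, and \<open>K * \<mu> \<le> (l r)\<^sup>2\<close> trades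
  \<open>\<mu> / l r\<close> for \<open>l r / K\<close>.\<close>

lemma
  assumes "Inv t"
  shows E_bound: "nrm (E t) \<le> 80 * l r * sqrt n / K" and S_bound: "S t \<le> 160 * sqrt n / K"
proof -
  define s where "s = (\<Sum>s<t. nrm (Dref s))"
  have a: "l r * s \<le> sqrt n" "0 \<le> s"
  proof -
    have "nrm (Dref t) + l r * s \<le> sqrt n" using assms by (simp only: Inv_def s_def)
    then show "l r * s \<le> sqrt n" using L2_set_nonneg[of "Dref t" "{1..r}"] by linarith
    show "0 \<le> s" unfolding s_def by (intro sum_nonneg L2_set_nonneg)
  qed
  have e: "nrm (E t) + l r * S t \<le> 80 * \<mu> * s + 40 * \<mu> * S t"
    using assms by (simp add: Inv_def s_def)
  have "80 * \<mu> * S t \<le> l r * S t" using mu_le S_nonneg by (intro mult_right_mono) auto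
  then have e2: "nrm (E t) + l r * S t / 2 \<le> 80 * \<mu> * s" using e by linarith
  have K0: "0 < K" using K by simp
  have "K * (80 * \<mu> * s) \<le> 80 * ((l r)\<^sup>2 * s)"
    using mult_right_mono[OF K(3) a(2)] by (simp add: algebra_simps)
  also have "\<dots> = 80 * l r * (l r * s)" by (simp add: power2_eq_square)
  also have "\<dots> \<le> 80 * l r * sqrt n" using a q by (intro mult_left_mono) auto
  finally have "80 * \<mu> * s \<le> 80 * l r * sqrt n / K" using K0 by (simp add: field_simps)
  with e2 have e3: "nrm (E t) + l r * S t / 2 \<le> 80 * l r * sqrt n / K" by linarith
  have "0 \<le> l r * S t" using q S_nonneg by simp
  with e3 show "nrm (E t) \<le> 80 * l r * sqrt n / K" by linarith
  have "l r * S t / 2 \<le> 80 * l r * sqrt n / K" using e3 L2_set_nonneg[of "E t" "{1..r}"] by linarith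
  then have "l r * S t \<le> l r * (160 * sqrt n / K)" by (simp add: field_simps)
  then show "S t \<le> 160 * sqrt n / K" using q by (simp only: mult_le_cancel_left_pos)
qed

lemma E_le_sqrt: assumes "Inv t" shows "nrm (E t) \<le> sqrt n"
proof -
  have "80 * l r * sqrt n / K \<le> sqrt n * (80 / K)" using q K n by (simp add: field_simps)
  also have "\<dots> \<le> sqrt n * 1" using K n by (intro mult_left_mono) auto
  finally show ?thesis using E_bound[OF assms] by simp
qed

lemma P_le: assumes "Inv t" shows "P t x \<le> Q x" "0 \<le> P t x"
proof -
  have d: "decay t i \<le> 1" if "i \<in> {1..r}" for i using assms that by (auto simp: Inv_def)
  have zx: "0 \<le> z i * \<bar>x i\<bar>" if "i \<in> {1..r}" for i using z_pos[OF that] by simp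
  show "P t x \<le> Q x" unfolding P_def Q_def
    by (intro sum_mono) (use zx decay_nonneg in \<open>simp add: left_diff_distrib\<close>)
  show "0 \<le> P t x" unfolding P_def
    by (intro sum_nonneg mult_nonneg_nonneg) (use z_pos d in \<open>auto simp: less_imp_le\<close>)
qed

text \<open>With \<open>P t \<le> Q\<close> and Cauchy-Schwarz the four products cost
  \<open>4 * w * n\<close>, which is \<open>16 * \<mu>\<close>; the deviation part adds at most one
  more \<open>\<mu>\<close>.\<close>

lemma bil_bound:
  assumes "Inv t" shows "\<bar>bil t y x\<bar> \<le> 17 * \<mu> * (nrm y * nrm x)"
proof -
  have yx: "Q y * Q x \<le> n * (nrm y * nrm x)"
  proof -
    have "Q y * Q x \<le> (sqrt n * nrm y) * (sqrt n * nrm x)"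
      using Q_le Q_nonneg n by (intro mult_mono) (auto simp: L2_set_nonneg)
    also have "\<dots> = (sqrt n * sqrt n) * (nrm y * nrm x)" by (simp only: mult_ac)
    finally show ?thesis using n by simp
  qed
  have p: "Q y * P t x \<le> Q y * Q x" "Q x * P t y \<le> Q y * Q x"
    using P_le(1)[OF assms] Q_nonneg by (simp_all add: mult_left_mono mult_right_mono mult.commute[of "Q y"])
  have main: "Q y * P t x + Q x * P t y + 2 * (Q y * P t x) \<le> 4 * (n * (nrm y * nrm x))"
    using yx p by linarith
  have m2: "w * (Q y * P t x + Q x * P t y + 2 * (Q y * P t x)) \<le> w * (4 * (n * (nrm y * nrm x)))"
    using main w_pos by (intro mult_left_mono) auto
  also have "\<dots> = 16 * \<mu> * (nrm y * nrm x)" using n by (simp add: w)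
  finally have m: "w * (Q y * P t x + Q x * P t y + 2 * (Q y * P t x)) \<le> 16 * \<mu> * (nrm y * nrm x)" .
  \<comment> \<open>The constant 7680 in the bound on \<open>K\<close> is 12 * 4 * 160: the
    coefficient of the deviation term, the 4 in \<open>w\<close>, and the bound on
    \<open>S t\<close>.\<close>
  have "12 * w * sqrt n * S t \<le> 12 * w * sqrt n * (160 * sqrt n / K)"
    using S_bound[OF assms] w_pos n by (intro mult_left_mono) auto
  also have "\<dots> = (sqrt n * sqrt n / n) * (7680 * \<mu> / K)" by (simp add: w)
  also have "\<dots> = 7680 * \<mu> / K" using n by simp
  also have "\<dots> \<le> \<mu>" using K mu by (simp add: field_simps)
  finally have "12 * w * sqrt n * S t * (nrm y * nrm x) \<le> \<mu> * (nrm y * nrm x)"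
    by (intro mult_right_mono) (auto simp: L2_set_nonneg)
  moreover have "\<bar>bil t y x\<bar> \<le> w * (Q y * P t x + Q x * P t y + 2 * (Q y * P t x))
          + 12 * w * sqrt n * S t * (nrm y * nrm x)" using assms by (simp add: Inv_def)
  ultimately show ?thesis using m by linarith
qed

section \<open>The sign of the alignment between output and residual\<close>

lemma F_eq: "F t i = z i * (1 - decay t i) + E t i" and D_eq: "D t i = E t i - z i * decay t i"
  by (auto simp: F_def E_def Dref_def algebra_simps)

text \<open>The negative alignment of output and residual along the reference trajectory.\<close>
definition N :: "nat \<Rightarrow> real" where
  "N t = (\<Sum>i\<in>{1..r}. (z i)\<^sup>2 * (decay t i * (1 - decay t i)))"

lemma z_decay_nrm:
  assumes "Inv t"
  shows "nrm (\<lambda>i. z i * (1 - decay t i)) \<le> sqrt n" "nrm (\<lambda>i. z i * decay t i) \<le> sqrt n"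
proof -
  have d: "decay t i \<le> 1" if "i \<in> {1..r}" for i using assms that by (auto simp: Inv_def)
  have "nrm (\<lambda>i. z i * (1 - decay t i)) \<le> 1 * nrm z"
    by (rule L2_set_cmult_le)
      (use d decay_nonneg in \<open>auto simp: abs_mult mult_le_cancel_left1 intro!: mult_left_le\<close>)
  then show "nrm (\<lambda>i. z i * (1 - decay t i)) \<le> sqrt n" by (simp add: nrm_z)
  have "nrm (\<lambda>i. z i * decay t i) \<le> 1 * nrm z"
    by (rule L2_set_cmult_le)
      (use d decay_nonneg in \<open>auto simp: abs_mult intro!: mult_left_le\<close>)
  then show "nrm (\<lambda>i. z i * decay t i) \<le> sqrt n" by (simp add: nrm_z)
qed

text \<open>Two terms linear in \<open>E\<close> and one quadratic in \<open>E\<close> cost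
  \<open>sqrt n * nrm (E t)\<close> each, the quadratic one because
  \<open>nrm (E t) \<le> sqrt n\<close>. In the single first coordinate the reference part has the
  right sign and is dropped, so the sum of both estimates costs six such terms.\<close>

lemma FD_le:
  assumes "Inv t"
  shows "ip (F t) (D t) \<le> - N t + 3 * sqrt n * nrm (E t)"
    and "F t 1 * D t 1 \<le> 3 * sqrt n * nrm (E t)"
proof -
  note zd = z_decay_nrm[OF assms]
  have e0: "0 \<le> nrm (E t)" by (rule L2_set_nonneg)
  have "ip (F t) (D t) = - N t + ip (\<lambda>i. z i * (1 - decay t i)) (E t)
      - ip (\<lambda>i. z i * decay t i) (E t) + ip (E t) (E t)"
    unfolding N_def sum_negf[symmetric] sum.distrib[symmetric] sum_subtractf[symmetric]
    by (intro sum.cong refl) (simp add: F_eq D_eq power2_eq_square algebra_simps)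
  moreover have "\<bar>ip (\<lambda>i. z i * (1 - decay t i)) (E t)\<bar> \<le> sqrt n * nrm (E t)"
    by (rule order_trans[OF abs_sum_mult_le_L2_set]) (use zd e0 in \<open>auto intro: mult_right_mono\<close>)
  moreover have "\<bar>ip (\<lambda>i. z i * decay t i) (E t)\<bar> \<le> sqrt n * nrm (E t)"
    by (rule order_trans[OF abs_sum_mult_le_L2_set]) (use zd e0 in \<open>auto intro: mult_right_mono\<close>)
  moreover have "\<bar>ip (E t) (E t)\<bar> \<le> sqrt n * nrm (E t)"
    by (rule order_trans[OF abs_sum_mult_le_L2_set])
      (use E_le_sqrt[OF assms] e0 in \<open>auto intro: mult_right_mono\<close>)
  ultimately show "ip (F t) (D t) \<le> - N t + 3 * sqrt n * nrm (E t)" by linarith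
  have d: "decay t 1 \<le> 1" using assms one_mem by (auto simp: Inv_def)
  have z1: "0 < z 1" "z 1 \<le> sqrt n"
    using z_pos[OF one_mem] member_le_L2_set[of "{1..r}" 1 z] one_mem nrm_z by auto
  have E1: "\<bar>E t 1\<bar> \<le> nrm (E t)"
    using member_le_L2_set[of "{1..r}" 1 "\<lambda>i. \<bar>E t i\<bar>"] one_mem by (simp add: L2_set_def)
  have "F t 1 * D t 1 = - ((z 1)\<^sup>2 * (decay t 1 * (1 - decay t 1))) + (z 1 * (1 - decay t 1)) * E t 1
     - (z 1 * decay t 1) * E t 1 + E t 1 * E t 1"
    by (simp add: F_eq D_eq power2_eq_square algebra_simps)
  moreover have "0 \<le> (z 1)\<^sup>2 * (decay t 1 * (1 - decay t 1))" using d decay_nonneg by simp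
  moreover have "(z 1 * (1 - decay t 1)) * E t 1 \<le> sqrt n * nrm (E t)"
  proof -
    have "z 1 * (1 - decay t 1) * E t 1 \<le> z 1 * (1 - decay t 1) * nrm (E t)"
      using E1 z1 d by (intro mult_left_mono) auto
    also have "\<dots> \<le> sqrt n * nrm (E t)"
      using z1 d decay_nonneg[of t 1] e0 mult_left_le[of "1 - decay t 1" "z 1"]
      by (intro mult_right_mono) linarith+
    finally show ?thesis .
  qed
  moreover have "- ((z 1 * decay t 1) * E t 1) \<le> sqrt n * nrm (E t)"
  proof -
    have "z 1 * decay t 1 * (- E t 1) \<le> z 1 * decay t 1 * nrm (E t)"
      using E1 z1 decay_nonneg[of t 1] by (intro mult_left_mono) auto
    also have "\<dots> \<le> sqrt n * nrm (E t)"
      using z1 d decay_nonneg[of t 1] e0 mult_left_le[of "decay t 1" "z 1"]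
      by (intro mult_right_mono) linarith+
    finally show ?thesis by simp
  qed
  moreover have "E t 1 * E t 1 \<le> sqrt n * nrm (E t)"
  proof -
    have "\<bar>E t 1\<bar> * \<bar>E t 1\<bar> \<le> sqrt n * nrm (E t)"
      using E1 E_le_sqrt[OF assms] e0 by (intro mult_mono) linarith+
    then show ?thesis by simp
  qed
  ultimately show "F t 1 * D t 1 \<le> 3 * sqrt n * nrm (E t)" by linarith
qed

lemma zeta_sq_le: "i \<in> {1..r} \<Longrightarrow> \<zeta>\<^sup>2 \<le> (z i)\<^sup>2"
  using z_ge zeta by (intro power_mono) auto

text \<open>Either some coordinate is neither untouched nor fully decayed, because consecutive
  eigenvalues have bounded ratio, or all coordinates have decayed by half and the size of the
  residual forces a lower bound.\<close>
lemma N_lower: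
  assumes I: "Inv t" and t: "1 \<le> t" "t \<le> T"
  shows "480 * l r * n / K < N t"
proof (cases "\<exists>i\<in>{1..r}. 1/2 \<le> decay t i")
  case True
  have d: "decay t i \<le> 1" if "i \<in> {1..r}" for i using I that by (auto simp: Inv_def)
  \<comment> \<open>At the least such index the predecessor has already lost more than half, and the
    chain condition carries a share \<open>1 / \<chi>\<close> of that progress over to
    \<open>k\<close>. So \<open>decay t k\<close> is bounded away from both 0 and 1.\<close>
  define k where "k = (LEAST i. i \<in> {1..r} \<and> 1/2 \<le> decay t i)"
  have k: "k \<in> {1..r}" "1/2 \<le> decay t k"
    using LeastI_ex[of "\<lambda>i. i \<in> {1..r} \<and> 1/2 \<le> decay t i"] True unfolding k_def by blast+
  have min: "decay t i < 1/2" if "i \<in> {1..r}" "i < k" for i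
    using not_less_Least[of i "\<lambda>i. i \<in> {1..r} \<and> 1/2 \<le> decay t i"] that unfolding k_def
    by (simp only: not_le de_Morgan_conj simp_thms)
  have nn: "0 \<le> (z i)\<^sup>2 * (decay t i * (1 - decay t i))" if "i \<in> {1..r}" for i
    using d[OF that] decay_nonneg by simp
  have "(z k)\<^sup>2 * (decay t k * (1 - decay t k)) \<le> N t"
    unfolding N_def by (rule member_le_sum[where f="\<lambda>i. (z i)\<^sup>2 * (decay t i * (1 - decay t i))"])
      (use k nn in auto)
  moreover have "\<zeta>\<^sup>2 * (1/2 * (1 - decay t k)) \<le> (z k)\<^sup>2 * (decay t k * (1 - decay t k))"
    using zeta_sq_le[OF k(1)] k d[OF k(1)] by (intro mult_mono) auto
  ultimately have N: "\<zeta>\<^sup>2 / 2 * (1 - decay t k) \<le> N t" by simp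
  show ?thesis
  proof (cases "k = 1")
    case True
    \<comment> \<open>There is no predecessor here; instead the first step alone has already moved
      the top coordinate by \<open>l 1\<close>.\<close>
    then have "l 1 \<le> 1 - decay t k" using I t by (simp add: Inv_def)
    then have "\<zeta>\<^sup>2 / 2 * l 1 \<le> \<zeta>\<^sup>2 / 2 * (1 - decay t k)" by (intro mult_left_mono) auto
    then show ?thesis using N small1 by linarith
  next
    case False
    then have k1: "k - 1 \<in> {1..<r}" "k - 1 < k" "k - 1 + 1 = k" using k by auto
    have "decay t (k - 1) < 1/2" using k1 by (intro min) auto
    moreover have "(1 - decay t (k - 1)) / \<chi> \<le> 1 - decay t (k - 1 + 1)"
      using I k1(1) unfolding Inv_def by blast
    moreover have "1 / 2 / \<chi> \<le> (1 - decay t (k - 1)) / \<chi>" if "decay t (k - 1) < 1/2"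
      using that chi by (intro divide_right_mono) auto
    ultimately have "1 / 2 / \<chi> \<le> 1 - decay t k"
      using k1(3) by simp
    then have "\<zeta>\<^sup>2 / 2 * (1 / 2 / \<chi>) \<le> \<zeta>\<^sup>2 / 2 * (1 - decay t k)" by (intro mult_left_mono) auto
    then show ?thesis using N small2 by (simp add: field_simps)
  qed
next
  case False
  then have h: "decay t i < 1/2" if "i \<in> {1..r}" for i using that by force
  have "D t = (\<lambda>i. Dref t i + E t i)" by (auto simp: E_def)
  then have "nrm (D t) \<le> nrm (Dref t) + nrm (E t)"
    using L2_set_triangle_ineq[of "Dref t" "E t" "{1..r}"] by simp
  then have "\<delta> / 2 \<le> nrm (Dref t)" using E_bound[OF I] small3 D_big[OF t(2)] by linarith
  also have "nrm (Dref t) = nrm (\<lambda>i. z i * decay t i)" by (simp add: L2_set_def Dref_def)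
  \<comment> \<open>The Euclidean norm is at most the sum of the entries, which is linear in
    \<open>decay\<close> and can be compared with \<open>N\<close> using
    \<open>\<zeta> \<le> z i\<close> and \<open>1/2 \<le> 1 - decay t i\<close>.\<close>
  also have "\<dots> \<le> (\<Sum>i\<in>{1..r}. z i * decay t i)"
    by (rule L2_set_le_sum) (use z_pos decay_nonneg in \<open>auto intro!: mult_nonneg_nonneg simp: less_imp_le\<close>)
  finally have s: "\<delta> / 2 \<le> (\<Sum>i\<in>{1..r}. z i * decay t i)" .
  have "\<zeta> / 2 * (\<delta> / 2) \<le> \<zeta> / 2 * (\<Sum>i\<in>{1..r}. z i * decay t i)"
    using s zeta by (intro mult_left_mono) auto
  also have "\<dots> = (\<Sum>i\<in>{1..r}. (\<zeta> * z i) * (decay t i * (1 / 2)))"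
    by (simp add: sum_distrib_left algebra_simps)
  also have "\<dots> \<le> N t" unfolding N_def
  proof (rule sum_mono)
    fix i assume i: "i \<in> {1..r}"
    show "\<zeta> * z i * (decay t i * (1 / 2)) \<le> (z i)\<^sup>2 * (decay t i * (1 - decay t i))"
      using z_ge[OF i] z_pos[OF i] h[OF i] decay_nonneg[of t i] zeta
      by (intro mult_mono) (auto simp: power2_eq_square)
  qed
  finally show ?thesis using small4 by simp
qed

lemma F_0: "i \<in> {1..r} \<Longrightarrow> F 0 i = 0" by (simp add: F_def D0)

text \<open>The threshold 480 is 6 * 80: six error terms from \<open>FD_le\<close>, each with the
  bound \<open>80 * l r * sqrt n / K\<close> on the deviation.\<close>

lemma alignment_neg:
  assumes I: "Inv t" and t: "1 \<le> t" "t \<le> T"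
  shows "ip (F t) (D t) < 0" "ip (F t) (D t) + F t 1 * D t 1 < 0"
proof -
  have "6 * sqrt n * nrm (E t) \<le> 6 * sqrt n * (80 * l r * sqrt n / K)"
    using E_bound[OF I] n by (intro mult_left_mono) auto
  also have "\<dots> = 480 * l r * n / K" using n by (simp add: field_simps)
  also have "\<dots> < N t" using N_lower[OF assms] .
  finally have a: "6 * sqrt n * nrm (E t) < N t" .
  have "0 \<le> sqrt n * nrm (E t)" using n L2_set_nonneg by simp
  then show "ip (F t) (D t) < 0" "ip (F t) (D t) + F t 1 * D t 1 < 0"
    using a FD_le[OF I] by linarith+
qed

text \<open>The weak inequality extends to \<open>t = 0\<close>, where the output vanishes; this is
  what starts the induction.\<close>

lemma alignment_le: assumes "Inv t" "t \<le> T" shows "ip (F t) (D t) \<le> 0"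
  using alignment_neg(1)[OF assms(1) _ assms(2)] F_0 by (cases t) (auto simp: less_imp_le)

section \<open>One-step propagation of the invariant\<close>

text \<open>The lower bounds come from the sign of the alignment. The upper bound comes from the
  stopping rule, which controls \<open>g t * l 1 + H t 1 1\<close>, and from the smallness of the
  single entry \<open>H t 1 1\<close>.\<close>

lemma g_bounds:
  assumes I: "Inv t" and t: "t \<le> T"
  shows "2 * b t \<le> g t" "1 \<le> g t" "1 \<le> b t" "\<And>i. i \<in> {1..r} \<Longrightarrow> g t * l i \<le> 1 + 40 * \<mu>"
proof -
  have FD: "(\<Sum>i\<in>{1..r}. (D t i + z i) * D t i) \<le> 0"
    using alignment_le[OF assms] by (simp add: F_def)
  then have "w * (\<Sum>i\<in>{1..r}. (D t i + z i) * D t i) \<le> 0" using w_pos by (simp add: mult_le_0_iff)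
  then show gb: "2 * b t \<le> g t" using g_ge[of t] by linarith
  show b1: "1 \<le> b t" using I by (simp add: Inv_def)
  show g1: "1 \<le> g t" using gb b1 by linarith
  let ?u = "\<lambda>i::nat. if i = 1 then 1 else (0::real)"
  have "nrm ?u = 1" using one_mem by (simp add: L2_set_def if_distrib[of "\<lambda>x. x\<^sup>2"] cong: if_cong)
  moreover have "bil t ?u ?u = H t 1 1"
    using one_mem by (simp add: bil_def if_distrib[of "\<lambda>x. x * _"] if_distrib[of "\<lambda>x. _ * x"] cong: if_cong)
  ultimately have "\<bar>H t 1 1\<bar> \<le> 17 * \<mu>" using bil_bound[OF I, of ?u ?u] by simp
  then have g1l: "g t * l 1 \<le> 1 + 40 * \<mu>" using sharp[OF t] mu by linarith
  fix i assume i: "i \<in> {1..r}"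
  have "g t * l i \<le> g t * l 1" using l_le[OF i] g1 by (intro mult_left_mono) auto
  then show "g t * l i \<le> 1 + 40 * \<mu>" using g1l by linarith
qed

text \<open>\<open>E\<close> follows the linear recursion of \<open>D\<close> with two sources: the
  action of \<open>H\<close>, and the negative part of a factor that the truncation in
  \<open>decay\<close> removed. Each is at most \<open>40 * \<mu>\<close> times a residual
  norm.\<close>

lemma E_step:
  assumes I: "Inv t" and t: "t \<le> T"
  shows "nrm (E (Suc t)) \<le> (1 - l r) * nrm (E t) + 40 * \<mu> * (2 * nrm (Dref t) + nrm (E t))"
proof -
  define h where "h i = (\<Sum>j\<in>{1..r}. H t i j * D t j)" for i
  \<comment> \<open>This source is nonzero only in coordinates where \<open>g t * l i\<close>
    exceeds 1.\<close>
  define f where "f i = ((1 - g t * l i) - max 0 (1 - g t * l i)) * Dref t i" for i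
  note gb = g_bounds[OF I t]
  have "nrm h \<le> 40 * \<mu> * nrm (D t)"
  proof (rule L2_set_le_of_self_pairing)
    have "ip h h = bil t h (D t)" by (simp add: bil_def h_def)
    also have "\<dots> \<le> 17 * \<mu> * (nrm h * nrm (D t))" using bil_bound[OF I, of h "D t"] by linarith
    also have "\<dots> \<le> 40 * \<mu> * (nrm h * nrm (D t))"
      using mu by (intro mult_right_mono) (auto simp: L2_set_nonneg)
    finally show "ip h h \<le> 40 * \<mu> * nrm (D t) * nrm h" by (simp add: mult_ac)
  qed (use mu L2_set_nonneg in auto)
  also have "nrm (D t) \<le> nrm (Dref t) + nrm (E t)"
  proof -
    have "D t = (\<lambda>i. Dref t i + E t i)" by (auto simp: E_def)
    then show ?thesis using L2_set_triangle_ineq[of "Dref t" "E t" "{1..r}"] by simp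
  qed
  finally have h: "nrm h \<le> 40 * \<mu> * (nrm (Dref t) + nrm (E t))" using mu by (simp add: mult_left_mono)
  have f: "nrm f \<le> 40 * \<mu> * nrm (Dref t)"
  proof (rule L2_set_cmult_le)
    fix i assume "i \<in> {1..r}"
    then have "\<bar>(1 - g t * l i) - max 0 (1 - g t * l i)\<bar> \<le> 40 * \<mu>"
      using gb(4)[of i] mu by (auto simp: max_def)
    then show "\<bar>f i\<bar> \<le> 40 * \<mu> * \<bar>Dref t i\<bar>"
      by (simp add: f_def abs_mult mult_right_mono)
  qed (use mu in auto)
  have c: "nrm (\<lambda>i. (1 - g t * l i) * E t i) \<le> (1 - l r) * nrm (E t)"
  proof (rule L2_set_cmult_le)
    fix i assume i: "i \<in> {1..r}"
    \<comment> \<open>The factor is bounded from both sides: from above by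
      \<open>g t \<ge> 1\<close>, and from below because an overshoot of \<open>40 * \<mu>\<close>
      still fits into \<open>1 - l r\<close>.\<close>
    have "l r \<le> l i" using l_ge[OF i] .
    also have "\<dots> \<le> g t * l i" using gb(2) l_pos[OF i] by (simp add: mult_le_cancel_right1)
    finally have "\<bar>1 - g t * l i\<bar> \<le> 1 - l r" using gb(4)[OF i] mu_le(2) by (simp add: abs_le_iff)
    then show "\<bar>(1 - g t * l i) * E t i\<bar> \<le> (1 - l r) * \<bar>E t i\<bar>"
      by (simp add: abs_mult mult_right_mono)
  qed (use q in auto)
  have "nrm (E (Suc t)) = nrm (\<lambda>i. ((1 - g t * l i) * E t i + f i) + - h i)"
    by (intro L2_set_cong refl)
      (simp add: E_def D_Suc f_def h_def Dref_def decay_Suc algebra_simps)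
  also have "\<dots> \<le> nrm (\<lambda>i. (1 - g t * l i) * E t i + f i) + nrm (\<lambda>i. - h i)"
    by (rule L2_set_triangle_ineq)
  also have "\<dots> \<le> nrm (\<lambda>i. (1 - g t * l i) * E t i) + nrm f + nrm (\<lambda>i. - h i)"
    using L2_set_triangle_ineq by simp
  also have "nrm (\<lambda>i. - h i) = nrm h" by (simp add: L2_set_def)
  finally show ?thesis using c f h by (simp add: algebra_simps)
qed

text \<open>In each of the three products of the increment one factor is bounded by \<open>Q\<close>
  and the other by \<open>R\<close>, the pairing with \<open>l i * Dref t i\<close>. Since
  \<open>R\<close> is at most the increase of \<open>P\<close>, the bound moves from
  \<open>P t\<close> to \<open>P (Suc t)\<close>, and all mixed terms with \<open>E\<close> go into
  \<open>S\<close>.\<close>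

lemma bil_step:
  assumes I: "Inv t" and t: "t \<le> T"
  shows "\<bar>bil (Suc t) y x\<bar> \<le> w * (Q y * P (Suc t) x + Q x * P (Suc t) y + 2 * (Q y * P (Suc t) x))
          + 12 * w * sqrt n * S (Suc t) * (nrm y * nrm x)"
proof -
  note gb = g_bounds[OF I t]
  define R where "R x = (\<Sum>i\<in>{1..r}. l i * (decay t i * (z i * \<bar>x i\<bar>)))" for x
  define e where "e = nrm (E t)"
  have e: "0 \<le> e" "e \<le> sqrt n" using E_le_sqrt[OF I] by (auto simp: e_def L2_set_nonneg)
  have d: "decay t i \<le> 1" if "i \<in> {1..r}" for i using I that by (auto simp: Inv_def)
  have lle: "l i \<le> 1" if "i \<in> {1..r}" for i using l_le[OF that] l1 by linarith
  have zx: "0 \<le> z i * \<bar>x i\<bar>" if "i \<in> {1..r}" for i x using z_pos[OF that] by simp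
  \<comment> \<open>The telescoping inequality: one step removes from \<open>decay t i\<close> the
    fraction \<open>1 - max 0 (1 - g t * l i)\<close>, which is at least \<open>l i\<close> because
    \<open>g t \<ge> 1\<close> and \<open>l i \<le> 1\<close>.\<close>
  have R_le_P: "R x \<le> P (Suc t) x - P t x" for x
    unfolding R_def P_def sum_subtractf[symmetric]
  proof (rule sum_mono)
    fix i assume i: "i \<in> {1..r}"
    have "l i \<le> g t * l i" using gb(2) l_pos[OF i] by (simp add: mult_le_cancel_right1)
    then have "l i \<le> 1 - max 0 (1 - g t * l i)" using lle[OF i] by (auto simp: max_def)
    then have "l i * (decay t i * (z i * \<bar>x i\<bar>)) \<le> (1 - max 0 (1 - g t * l i)) * (decay t i * (z i * \<bar>x i\<bar>))"
      using zx[OF i] decay_nonneg by (intro mult_right_mono) auto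
    then show "l i * (decay t i * (z i * \<bar>x i\<bar>))
        \<le> (1 - decay (Suc t) i) * (z i * \<bar>x i\<bar>) - (1 - decay t i) * (z i * \<bar>x i\<bar>)"
      by (simp add: decay_Suc algebra_simps)
  qed
  have R0: "0 \<le> R x" for x unfolding R_def
    by (intro sum_nonneg mult_nonneg_nonneg decay_nonneg) (use zx l_pos z_pos in \<open>auto simp: less_imp_le\<close>)
  have R_le: "R x \<le> sqrt n * nrm x" for x
  proof -
    have "R x \<le> Q x" unfolding R_def Q_def
    proof (rule sum_mono)
      fix i assume i: "i \<in> {1..r}"
      have "l i * decay t i \<le> 1 * 1"
        using lle[OF i] d[OF i] l_pos[OF i] decay_nonneg by (intro mult_mono) auto
      then have "(l i * decay t i) * (z i * \<bar>x i\<bar>) \<le> 1 * (z i * \<bar>x i\<bar>)"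
        using zx[OF i] by (intro mult_right_mono) auto
      then show "l i * (decay t i * (z i * \<bar>x i\<bar>)) \<le> z i * \<bar>x i\<bar>" by simp
    qed
    then show ?thesis using Q_le order_trans by blast
  qed
  \<comment> \<open>Common pattern of the next three estimates: a reference part bounded by weighted
    sums, plus the deviation with coefficients at most 1.\<close>
  have gen: "\<bar>ip (\<lambda>i. c i + k i * E t i) y\<bar> \<le> a + e * nrm y"
    if c: "(\<Sum>i\<in>{1..r}. \<bar>c i\<bar> * \<bar>y i\<bar>) \<le> a" and k: "\<And>i. i \<in> {1..r} \<Longrightarrow> \<bar>k i\<bar> \<le> 1" for c k y a
  proof -
    have "ip (\<lambda>i. c i + k i * E t i) y = (\<Sum>i\<in>{1..r}. c i * y i) + ip (\<lambda>i. k i * E t i) y"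
      by (simp add: sum.distrib[symmetric] algebra_simps)
    moreover have "\<bar>\<Sum>i\<in>{1..r}. c i * y i\<bar> \<le> a"
      by (rule order_trans[OF sum_abs]) (use c in \<open>simp add: abs_mult\<close>)
    moreover have "\<bar>ip (\<lambda>i. k i * E t i) y\<bar> \<le> nrm (\<lambda>i. k i * E t i) * nrm y"
      by (rule abs_sum_mult_le_L2_set)
    moreover have "nrm (\<lambda>i. k i * E t i) \<le> 1 * e" unfolding e_def
      by (rule L2_set_cmult_le) (use k in \<open>auto simp: abs_mult intro!: mult_left_le_one_le\<close>)
    then have "nrm (\<lambda>i. k i * E t i) * nrm y \<le> e * nrm y"
      by (intro mult_right_mono) (auto simp: L2_set_nonneg)
    ultimately show ?thesis by linarith
  qed
  have Fy: "\<bar>ip (F t) y\<bar> \<le> Q y + e * nrm y" for y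
  proof -
    have "\<bar>ip (\<lambda>i. z i * (1 - decay t i) + 1 * E t i) y\<bar> \<le> Q y + e * nrm y"
    proof (rule gen)
      show "(\<Sum>i\<in>{1..r}. \<bar>z i * (1 - decay t i)\<bar> * \<bar>y i\<bar>) \<le> Q y" unfolding Q_def
      proof (rule sum_mono)
        fix i assume i: "i \<in> {1..r}"
        show "\<bar>z i * (1 - decay t i)\<bar> * \<bar>y i\<bar> \<le> z i * \<bar>y i\<bar>"
          using d[OF i] decay_nonneg[of t i] z_pos[OF i]
          by (intro mult_right_mono) (auto simp: abs_mult intro!: mult_left_le)
      qed
    qed auto
    then show ?thesis by (simp add: F_eq)
  qed
  have lDx: "\<bar>ip (\<lambda>i. l i * D t i) y\<bar> \<le> R y + e * nrm y" for y
  proof -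
    have "\<bar>ip (\<lambda>i. - (l i * (decay t i * z i)) + l i * E t i) y\<bar> \<le> R y + e * nrm y"
    proof (rule gen)
      show "(\<Sum>i\<in>{1..r}. \<bar>- (l i * (decay t i * z i))\<bar> * \<bar>y i\<bar>) \<le> R y" unfolding R_def
        by (intro sum_mono) (use l_pos z_pos decay_nonneg in \<open>auto simp: abs_mult less_imp_le\<close>)
      show "\<bar>l i\<bar> \<le> 1" if "i \<in> {1..r}" for i using l_pos[OF that] lle[OF that] by simp
    qed
    then show ?thesis by (simp add: D_eq algebra_simps)
  qed
  \<comment> \<open>In the quadratic term the factor \<open>b t\<close> is attached to one copy of
    \<open>l i * D t i\<close>: twice \<open>b t * l i\<close> is at most \<open>g t * l i\<close>,
    hence at most 2, and that copy is bounded by \<open>Q\<close>.\<close>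
  have bl: "0 \<le> b t * l i" "b t * l i \<le> 1" if "i \<in> {1..r}" for i
  proof -
    have "2 * (b t * l i) \<le> g t * l i" using gb(1) l_pos[OF that]
      by (simp add: mult.assoc[symmetric] mult_right_mono)
    then show "b t * l i \<le> 1" using gb(4)[OF that] mu_le(3) by linarith
    show "0 \<le> b t * l i" using gb(3) l_pos[OF that] by simp
  qed
  have bDy: "\<bar>b t * ip (\<lambda>i. l i * D t i) y\<bar> \<le> Q y + e * nrm y" for y
  proof -
    have "\<bar>ip (\<lambda>i. - ((b t * l i) * (decay t i * z i)) + (b t * l i) * E t i) y\<bar> \<le> Q y + e * nrm y"
    proof (rule gen)
      show "(\<Sum>i\<in>{1..r}. \<bar>- ((b t * l i) * (decay t i * z i))\<bar> * \<bar>y i\<bar>) \<le> Q y" unfolding Q_def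
      proof (rule sum_mono)
        fix i assume i: "i \<in> {1..r}"
        have "(b t * l i) * decay t i \<le> 1 * 1"
          using bl[OF i] d[OF i] decay_nonneg by (intro mult_mono) auto
        then have "((b t * l i) * decay t i) * z i * \<bar>y i\<bar> \<le> 1 * z i * \<bar>y i\<bar>"
          using z_pos[OF i] by (intro mult_right_mono) auto
        moreover have "\<bar>- ((b t * l i) * (decay t i * z i))\<bar> = ((b t * l i) * decay t i) * z i"
          unfolding abs_minus_cancel abs_mult[of "b t * l i"] using bl[OF i] z_pos[OF i] decay_nonneg[of t i]
          by (simp add: abs_mult[of "decay t i"])
        ultimately show "\<bar>- ((b t * l i) * (decay t i * z i))\<bar> * \<bar>y i\<bar> \<le> z i * \<bar>y i\<bar>" by simp
      qed
      show "\<bar>b t * l i\<bar> \<le> 1" if "i \<in> {1..r}" for i using bl[OF that] by simp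
    qed
    moreover have "ip (\<lambda>i. - ((b t * l i) * (decay t i * z i)) + (b t * l i) * E t i) y
        = b t * ip (\<lambda>i. l i * D t i) y"
      by (simp add: D_eq sum_distrib_left algebra_simps)
    ultimately show ?thesis by simp
  qed
  have prod: "\<bar>u * v\<bar> \<le> Q y * R x + 3 * sqrt n * e * (nrm y * nrm x)"
    if u: "\<bar>u\<bar> \<le> Q y + e * nrm y" and v: "\<bar>v\<bar> \<le> R x + e * nrm x" for u v x y
  proof -
    have ny: "0 \<le> nrm y" "0 \<le> nrm x" by (auto simp: L2_set_nonneg)
    have "\<bar>u * v\<bar> \<le> (Q y + e * nrm y) * (R x + e * nrm x)" unfolding abs_mult
      using u v e ny Q_nonneg[of y] by (intro mult_mono) auto
    also have "\<dots> = Q y * R x + Q y * (e * nrm x) + R x * (e * nrm y) + e * (e * (nrm y * nrm x))"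
      by (simp add: algebra_simps)
    also have "Q y * (e * nrm x) \<le> (sqrt n * nrm y) * (e * nrm x)"
      using Q_le e ny by (intro mult_right_mono) auto
    also have "R x * (e * nrm y) \<le> (sqrt n * nrm x) * (e * nrm y)"
      using R_le e ny by (intro mult_right_mono) auto
    also have "e * (e * (nrm y * nrm x)) \<le> sqrt n * (e * (nrm y * nrm x))"
      using e ny by (intro mult_right_mono) auto
    finally show ?thesis by (simp add: algebra_simps)
  qed
  let ?lD = "\<lambda>i. l i * D t i"
  define X where "X = sqrt n * e * (nrm y * nrm x)"
  have p1: "\<bar>ip (F t) y * ip ?lD x\<bar> \<le> Q y * R x + 3 * X"
    using prod[OF Fy[of y] lDx[of x]] by (simp add: X_def)
  have p2: "\<bar>ip ?lD y * ip (F t) x\<bar> \<le> Q x * R y + 3 * X"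
    using prod[OF Fy[of x] lDx[of y]] by (simp add: X_def mult_ac)
  have p3: "\<bar>(b t * ip ?lD y) * ip ?lD x\<bar> \<le> Q y * R x + 3 * X"
    using prod[OF bDy[of y] lDx[of x]] by (simp add: X_def)
  have "bil (Suc t) y x = bil t y x + w * (2 * ((b t * ip ?lD y) * ip ?lD x)
      - ip (F t) y * ip ?lD x - ip ?lD y * ip (F t) x)"
    unfolding bil_Suc by (simp add: algebra_simps)
  then have "\<bar>bil (Suc t) y x\<bar> \<le> \<bar>bil t y x\<bar> + \<bar>w * (2 * ((b t * ip ?lD y) * ip ?lD x)
      - ip (F t) y * ip ?lD x - ip ?lD y * ip (F t) x)\<bar>" by linarith
  also have "\<dots> = \<bar>bil t y x\<bar> + w * \<bar>2 * ((b t * ip ?lD y) * ip ?lD x)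
      - ip (F t) y * ip ?lD x - ip ?lD y * ip (F t) x\<bar>" using w_pos by (simp add: abs_mult)
  also have "\<dots> \<le> \<bar>bil t y x\<bar> + w * (Q y * R x + Q x * R y + 2 * (Q y * R x) + 12 * X)"
    \<comment> \<open>The coefficient 12 is 3 + 3 + 2 * 3, since the product with \<open>b t\<close>
      enters twice.\<close>
    using p1 p2 p3 w_pos by (intro add_left_mono mult_left_mono) linarith+
  also have "\<bar>bil t y x\<bar> \<le> w * (Q y * P t x + Q x * P t y + 2 * (Q y * P t x))
          + 12 * w * sqrt n * S t * (nrm y * nrm x)" using I by (simp add: Inv_def)
  also have "w * (Q y * P t x + Q x * P t y + 2 * (Q y * P t x))
          + 12 * w * sqrt n * S t * (nrm y * nrm x)
          + w * (Q y * R x + Q x * R y + 2 * (Q y * R x) + 12 * X)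
     = w * (Q y * (P t x + R x) + Q x * (P t y + R y) + 2 * (Q y * (P t x + R x)))
       + 12 * w * sqrt n * S (Suc t) * (nrm y * nrm x)"
    by (simp add: S_def X_def e_def algebra_simps)
  also have "\<dots> \<le> w * (Q y * P (Suc t) x + Q x * P (Suc t) y + 2 * (Q y * P (Suc t) x))
       + 12 * w * sqrt n * S (Suc t) * (nrm y * nrm x)"
    using R_le_P[of x] R_le_P[of y] Q_nonneg w_pos
    by (intro add_right_mono mult_left_mono add_mono) auto
  finally show ?thesis by simp
qed

lemma Inv_Suc: assumes I: "Inv t" and t: "t \<le> T" shows "Inv (Suc t)"
proof -
  note gb = g_bounds[OF I t]
  have d: "decay t i \<le> 1" if "i \<in> {1..r}" for i using I that by (auto simp: Inv_def)
  define p where "p i = max 0 (1 - g t * l i)" for i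
  have dS: "decay (Suc t) i = decay t i * p i" for i by (simp add: decay_Suc p_def)
  have lg: "l i \<le> g t * l i" if "i \<in> {1..r}" for i
    using gb(2) l_pos[OF that] by (simp add: mult_le_cancel_right1)
  have p0: "0 \<le> p i" for i by (simp add: p_def)
  have p1: "p i \<le> 1 - l i" if "i \<in> {1..r}" for i
    using lg[OF that] l_le[OF that] l1 by (auto simp: p_def)
  have p1': "p i \<le> 1" if "i \<in> {1..r}" for i using p1[OF that] l_pos[OF that] by linarith
  have b: "1 \<le> b (Suc t)"
  proof -
    have "w * (\<Sum>i\<in>{1..r}. (D t i + z i) * D t i) \<le> 0"
      using alignment_le[OF assms] w_pos by (simp add: F_def mult_le_0_iff)
    then show ?thesis using b_Suc[of t] gb(3) by linarith
  qed
  have dec: "\<forall>i\<in>{1..r}. decay (Suc t) i \<le> 1"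
  proof
    fix i assume i: "i \<in> {1..r}"
    have "decay t i * p i \<le> 1 * 1" using d[OF i] p0 p1'[OF i] decay_nonneg by (intro mult_mono) auto
    then show "decay (Suc t) i \<le> 1" by (simp add: dS)
  qed
  have ch: "\<forall>i\<in>{1..<r}. (1 - decay (Suc t) i) / \<chi> \<le> 1 - decay (Suc t) (i + 1)"
  proof
    fix i assume i: "i \<in> {1..<r}"
    then have ii: "i \<in> {1..r}" "i + 1 \<in> {1..r}" by auto
    have h: "(1 - decay t i) / \<chi> \<le> 1 - decay t (i + 1)" using I i by (auto simp: Inv_def)
    have gx: "g t * l i \<le> \<chi> * (g t * l (i + 1))"
      using mult_left_mono[OF chain[OF i], of "g t"] gb(2) by (simp add: mult_ac)
    \<comment> \<open>The left side is the minimum of \<open>a\<close> and 1, so the eigenvalue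
      ratio bound survives the truncation because \<open>\<chi> > 1\<close>.\<close>
    have "1 - max 0 (1 - a) \<le> \<chi> * (1 - max 0 (1 - c))" if "a \<le> \<chi> * c" for a c :: real
      using that chi by (auto simp: max_def)
    from this[OF gx] have p: "(1 - p i) \<le> \<chi> * (1 - p (i + 1))" by (simp only: p_def)
    have h': "1 - decay t i \<le> \<chi> * (1 - decay t (i + 1))" using h chi by (simp add: field_simps)
    \<comment> \<open>New progress plus the retained share of old progress. The old part is compared
      by the invariant and the new part by the ratio bound; regrouping around
      \<open>decay t (i + 1)\<close> lets both comparisons be used at once.\<close>
    have "1 - decay t i * p i = (1 - p i) + p i * (1 - decay t i)" by (simp add: algebra_simps)
    also have "\<dots> \<le> (1 - p i) + p i * (\<chi> * (1 - decay t (i + 1)))"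
      using h' p0 by (intro add_left_mono mult_left_mono) auto
    also have "\<dots> = (1 - p i) * (1 - \<chi> * (1 - decay t (i + 1))) + \<chi> * (1 - decay t (i + 1))"
      by (simp add: algebra_simps)
    also have "\<dots> \<le> \<chi> * (1 - p (i+1)) * decay t (i + 1) + \<chi> * (1 - decay t (i + 1))"
    proof (rule add_right_mono)
      have "(1 - p i) * (1 - \<chi> * (1 - decay t (i + 1))) \<le> (1 - p i) * decay t (i + 1)"
      proof (rule mult_left_mono)
        have "1 * (1 - decay t (i + 1)) \<le> \<chi> * (1 - decay t (i + 1))"
          using chi d[OF ii(2)] by (intro mult_right_mono) auto
        then show "1 - \<chi> * (1 - decay t (i + 1)) \<le> decay t (i + 1)" by (simp add: algebra_simps)
      qed (use p1'[OF ii(1)] in auto)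
      also have "\<dots> \<le> \<chi> * (1 - p (i + 1)) * decay t (i + 1)"
        using p decay_nonneg by (intro mult_right_mono) auto
      finally show "(1 - p i) * (1 - \<chi> * (1 - decay t (i + 1))) \<le> \<chi> * (1 - p (i + 1)) * decay t (i + 1)" .
    qed
    also have "\<dots> = \<chi> * (1 - decay t (i + 1) * p (i + 1))" by (simp add: algebra_simps)
    finally show "(1 - decay (Suc t) i) / \<chi> \<le> 1 - decay (Suc t) (i + 1)"
      using chi by (simp add: dS field_simps)
  qed
  have one: "l 1 \<le> 1 - decay (Suc t) 1"
  proof -
    have "decay t 1 * p 1 \<le> 1 * p 1" using d[OF one_mem] p0 by (intro mult_right_mono) auto
    then show ?thesis using p1[OF one_mem] by (simp add: dS)
  qed
  have "nrm (Dref (Suc t)) \<le> (1 - l r) * nrm (Dref t)"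
  proof (rule L2_set_cmult_le)
    fix i assume i: "i \<in> {1..r}"
    have "\<bar>Dref (Suc t) i\<bar> = p i * \<bar>Dref t i\<bar>" using p0[of i] by (simp add: Dref_def dS abs_mult)
    moreover have "p i \<le> 1 - l r" using p1[OF i] l_ge[OF i] by linarith
    ultimately show "\<bar>Dref (Suc t) i\<bar> \<le> (1 - l r) * \<bar>Dref t i\<bar>" by (simp add: mult_right_mono)
  qed (use q in auto)
  moreover have "nrm (Dref t) + l r * (\<Sum>s<t. nrm (Dref s)) \<le> sqrt n"
    using I by (simp add: Inv_def)
  ultimately have D: "nrm (Dref (Suc t)) + l r * (\<Sum>s<Suc t. nrm (Dref s)) \<le> sqrt n"
    by (simp add: algebra_simps)
  have "nrm (E t) + l r * S t \<le> 80 * \<mu> * (\<Sum>s<t. nrm (Dref s)) + 40 * \<mu> * S t"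
    using I by (simp add: Inv_def)
  \<comment> \<open>The amount \<open>l r * nrm (E t)\<close> lost by contraction is exactly what
    the running sum \<open>l r * S\<close> gains.\<close>
  then have E: "nrm (E (Suc t)) + l r * S (Suc t)
      \<le> 80 * \<mu> * (\<Sum>s<Suc t. nrm (Dref s)) + 40 * \<mu> * S (Suc t)"
    using E_step[OF assms] by (simp add: S_def algebra_simps)
  show ?thesis unfolding Inv_def using b dec ch one D E bil_step[OF assms] by blast
qed

lemma Inv_all: "t \<le> T \<Longrightarrow> Inv t"
  by (induction t) (auto intro: Inv_0 Inv_Suc)

theorem conclusion:
  assumes "1 \<le> t" "t \<le> T"
  shows "ip (F t) (D t) + F t 1 * D t 1 < 0"
    and "\<bar>bil t y x\<bar> \<le> 40 * \<mu> * (nrm y * nrm x)"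
proof -
  have I: "Inv t" using Inv_all assms by simp
  show "ip (F t) (D t) + F t 1 * D t 1 < 0" using alignment_neg(2)[OF I assms] .
  have "17 * \<mu> * (nrm y * nrm x) \<le> 40 * \<mu> * (nrm y * nrm x)"
    using mu by (intro mult_right_mono) (auto simp: L2_set_nonneg)
  then show "\<bar>bil t y x\<bar> \<le> 40 * \<mu> * (nrm y * nrm x)" using bil_bound[OF I, of y x] by linarith
qed

end

section \<open>Quadratic forms and the largest eigenvalue of a symmetric matrix\<close>

lemma smult_mat_mult_vec:
  assumes "B \<in> carrier_mat a b" "x \<in> carrier_vec b"
  shows "(k \<cdot>\<^sub>m B) *\<^sub>v x = (k :: 'a :: comm_ring_1) \<cdot>\<^sub>v (B *\<^sub>v x)"
  using assms by (intro eq_vecI) (auto simp: scalar_prod_def sum_distrib_left mult.assoc)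

lemma scalar_prod_self_eq_sum: "(x :: real vec) \<bullet> x = (\<Sum>i<dim_vec x. (x $ i)\<^sup>2)"
  by (simp add: scalar_prod_def power2_eq_square lessThan_atLeast0)

lemma scalar_prod_self_nonneg: "0 \<le> (x :: real vec) \<bullet> x"
  unfolding scalar_prod_self_eq_sum by (intro sum_nonneg) auto

lemma scalar_prod_self_eq_0_iff:
  "(x :: real vec) \<in> carrier_vec n \<Longrightarrow> x \<bullet> x = 0 \<longleftrightarrow> x = 0\<^sub>v n"
  unfolding scalar_prod_self_eq_sum by (auto simp: sum_nonneg_eq_0_iff)

lemma scalar_prod_Cauchy_Schwarz:
  fixes x y :: "real vec"
  assumes "x \<in> carrier_vec n" "y \<in> carrier_vec n"
  shows "(x \<bullet> y)\<^sup>2 \<le> (x \<bullet> x) * (y \<bullet> y)"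
proof -
  have "\<bar>\<Sum>i\<in>{0..<n}. x $ i * y $ i\<bar> \<le> L2_set (\<lambda>i. x $ i) {0..<n} * L2_set (\<lambda>i. y $ i) {0..<n}"
    by (rule order_trans[OF sum_abs], simp add: abs_mult, rule L2_set_mult_ineq)
  then have "(\<Sum>i\<in>{0..<n}. x $ i * y $ i)\<^sup>2
      \<le> (L2_set (\<lambda>i. x $ i) {0..<n} * L2_set (\<lambda>i. y $ i) {0..<n})\<^sup>2"
    by (rule power2_le_iff_abs_le[THEN iffD2, rotated]) (simp add: L2_set_nonneg)
  then show ?thesis using assms
    by (simp add: power_mult_distrib L2_set_def sum_nonneg scalar_prod_def power2_eq_square[symmetric])
qed

lemma mult_mat_vec_bounded:
  fixes B :: "real mat"
  assumes B: "B \<in> carrier_mat k n"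
  obtains C where "C > 0" "\<And>x. x \<in> carrier_vec n \<Longrightarrow> (B *\<^sub>v x) \<bullet> (B *\<^sub>v x) \<le> C * (x \<bullet> x)"
proof
  define C where "C = (\<Sum>i<k. row B i \<bullet> row B i) + 1"
  have "0 \<le> (\<Sum>i<k. row B i \<bullet> row B i)" by (intro sum_nonneg scalar_prod_self_nonneg)
  then show "C > 0" by (simp add: C_def)
  fix x :: "real vec" assume x: "x \<in> carrier_vec n"
  have "(B *\<^sub>v x) \<bullet> (B *\<^sub>v x) = (\<Sum>i<k. (row B i \<bullet> x)\<^sup>2)"
    using B by (simp add: scalar_prod_self_eq_sum)
  also have "\<dots> \<le> (\<Sum>i<k. (row B i \<bullet> row B i) * (x \<bullet> x))"
    using B x by (intro sum_mono scalar_prod_Cauchy_Schwarz[of _ n]) auto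
  also have "\<dots> \<le> C * (x \<bullet> x)"
    using scalar_prod_self_nonneg[of x] by (simp add: C_def sum_distrib_right distrib_right)
  finally show "(B *\<^sub>v x) \<bullet> (B *\<^sub>v x) \<le> C * (x \<bullet> x)" .
qed

lemma invertible_mat_bounded_below:
  fixes B :: "real mat"
  assumes B: "B \<in> carrier_mat n n" and d: "det B \<noteq> 0"
  obtains C where "C > 0" "\<And>x. x \<in> carrier_vec n \<Longrightarrow> x \<bullet> x \<le> C * ((B *\<^sub>v x) \<bullet> (B *\<^sub>v x))"
proof -
  obtain Q where Q: "Q \<in> carrier_mat n n" "Q * B = 1\<^sub>m n"
    using det_non_zero_imp_unit[OF B d, of "()"] unfolding Units_def ring_mat_def by auto
  obtain C where C: "C > 0" "\<And>x. x \<in> carrier_vec n \<Longrightarrow> (Q *\<^sub>v x) \<bullet> (Q *\<^sub>v x) \<le> C * (x \<bullet> x)"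
    using mult_mat_vec_bounded[OF Q(1)] by blast
  show thesis
  proof (rule that[OF C(1)])
    fix x :: "real vec" assume x: "x \<in> carrier_vec n"
    have "Q *\<^sub>v (B *\<^sub>v x) = x" using assoc_mult_mat_vec[OF Q(1) B x] Q(2) x by simp
    then show "x \<bullet> x \<le> C * ((B *\<^sub>v x) \<bullet> (B *\<^sub>v x))"
      using C(2)[of "B *\<^sub>v x"] B x by simp
  qed
qed

text \<open>Nonnegativity of the form is applied at \<open>x - s P x\<close> for a small
  \<open>s\<close>: the term linear in \<open>s\<close> then forces the form at \<open>x\<close> to
  dominate the squared norm of \<open>P x\<close>.\<close>

lemma psd_form_bounded_below:
  fixes P :: "real mat"
  assumes P: "P \<in> carrier_mat n n"
    and sym: "\<And>x y. x \<in> carrier_vec n \<Longrightarrow> y \<in> carrier_vec n \<Longrightarrow> x \<bullet> (P *\<^sub>v y) = y \<bullet> (P *\<^sub>v x)"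
    and psd: "\<And>x. x \<in> carrier_vec n \<Longrightarrow> 0 \<le> x \<bullet> (P *\<^sub>v x)"
  obtains C where "C > 0"
    "\<And>x. x \<in> carrier_vec n \<Longrightarrow> (P *\<^sub>v x) \<bullet> (P *\<^sub>v x) \<le> C * (x \<bullet> (P *\<^sub>v x))"
proof -
  obtain C where C: "C > 0" "\<And>x. x \<in> carrier_vec n \<Longrightarrow> (P *\<^sub>v x) \<bullet> (P *\<^sub>v x) \<le> C * (x \<bullet> x)"
    using mult_mat_vec_bounded[OF P] by blast
  \<comment> \<open>With this choice the quadratic term is at most \<open>s * Y\<close>, half of the
    linear term \<open>2 * s * Y\<close>, so \<open>s * Y\<close> survives.\<close>
  define s where "s = 1 / (C + 1)"
  have s: "0 < s" "s * (C + 1) = 1" using C(1) by (auto simp: s_def)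
  show thesis
  proof (rule that[of "C + 1"])
    fix x :: "real vec" assume x: "x \<in> carrier_vec n"
    define y where "y = P *\<^sub>v x"
    have y: "y \<in> carrier_vec n" using P x by (simp add: y_def)
    have Py: "P *\<^sub>v y \<in> carrier_vec n" using P y by simp
    define Y where "Y = y \<bullet> y"
    have Y0: "0 \<le> Y" by (simp add: Y_def scalar_prod_self_nonneg)
    have "(y \<bullet> (P *\<^sub>v y))\<^sup>2 \<le> Y * (C * Y)"
      using scalar_prod_Cauchy_Schwarz[OF y Py] mult_left_mono[OF C(2)[OF y] Y0] by (simp add: Y_def)
    also have "\<dots> \<le> ((C + 1) * Y)\<^sup>2" 
    proof -
      have "C * (Y * Y) \<le> (C + 1)\<^sup>2 * (Y * Y)"
        using C(1) Y0 by (intro mult_right_mono) (auto simp: power2_eq_square algebra_simps)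
      then show ?thesis by (simp add: power2_eq_square mult_ac)
    qed
    finally have yPy: "y \<bullet> (P *\<^sub>v y) \<le> (C + 1) * Y"
      using C(1) Y0 by (auto intro: power2_le_imp_le)
    have sy: "s \<cdot>\<^sub>v y \<in> carrier_vec n" using y by simp
    have "0 \<le> (x - s \<cdot>\<^sub>v y) \<bullet> (P *\<^sub>v (x - s \<cdot>\<^sub>v y))" using psd x y by simp
    also have "P *\<^sub>v (x - s \<cdot>\<^sub>v y) = y - s \<cdot>\<^sub>v (P *\<^sub>v y)"
      using mult_minus_distrib_mat_vec[OF P x sy] mult_mat_vec[OF P y] by (simp add: y_def)
    also have "(x - s \<cdot>\<^sub>v y) \<bullet> (y - s \<cdot>\<^sub>v (P *\<^sub>v y))
        = x \<bullet> y - s * (x \<bullet> (P *\<^sub>v y)) - s * Y + s * s * (y \<bullet> (P *\<^sub>v y))"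
      using x y Py sy
      by (simp add: minus_scalar_prod_distrib[of _ n] scalar_prod_minus_distrib[of _ n] Y_def algebra_simps)
    also have "x \<bullet> (P *\<^sub>v y) = Y" using sym[OF x y] by (simp add: Y_def y_def)
    finally have "2 * s * Y \<le> x \<bullet> y + s * (s * (y \<bullet> (P *\<^sub>v y)))" by (simp add: algebra_simps)
    also have "s * (s * (y \<bullet> (P *\<^sub>v y))) \<le> s * (s * ((C + 1) * Y))"
      using yPy s by (intro mult_left_mono) auto
    also have "\<dots> = s * Y" using s(2) by (simp add: mult.assoc[symmetric])
    finally have "s * Y \<le> x \<bullet> y" by linarith
    then have "(C + 1) * (s * Y) \<le> (C + 1) * (x \<bullet> y)" using C(1) by (intro mult_left_mono) auto
    then show "(P *\<^sub>v x) \<bullet> (P *\<^sub>v x) \<le> (C + 1) * (x \<bullet> (P *\<^sub>v x))"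
      using s(2) by (simp add: mult.assoc[symmetric] mult.commute Y_def y_def)
  qed (use C in simp)
qed

text \<open>\<open>lambda_max\<close> is a \<open>Max\<close>, which is meaningful as an upper bound
  only over a finite set.\<close>

lemma finite_eigenvalues:
  assumes "(B :: 'a :: field mat) \<in> carrier_mat n n"
  shows "finite {k. eigenvalue B k}"
proof -
  have "char_poly B \<noteq> 0" using degree_monic_char_poly[OF assms] by auto
  then show ?thesis unfolding eigenvalue_root_char_poly[OF assms] by (rule poly_roots_finite)
qed

text \<open>With \<open>\<mu>\<close> the supremum of the Rayleigh quotient, \<open>\<mu> I - B\<close> is positive semidefinite
  and annihilated approximately by unit vectors. Invertibility of \<open>\<mu> I - B\<close> would exclude
  that, so no compactness argument is needed to see that \<open>\<mu>\<close> is an eigenvalue.\<close>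
lemma Rayleigh_le_lambda_max:
  fixes B :: "real mat"
  assumes B: "B \<in> carrier_mat n n"
    and sym: "\<And>x y. x \<in> carrier_vec n \<Longrightarrow> y \<in> carrier_vec n \<Longrightarrow> x \<bullet> (B *\<^sub>v y) = y \<bullet> (B *\<^sub>v x)"
    and u: "u \<in> carrier_vec n" "u \<bullet> u = 1"
  shows "u \<bullet> (B *\<^sub>v u) \<le> lambda_max B"
proof -
  define R where "R = {x \<bullet> (B *\<^sub>v x) | x. x \<in> carrier_vec n \<and> x \<bullet> x = 1}"
  define \<mu> where "\<mu> = Sup R"
  obtain C where C: "C > 0" "\<And>x. x \<in> carrier_vec n \<Longrightarrow> (B *\<^sub>v x) \<bullet> (B *\<^sub>v x) \<le> C * (x \<bullet> x)"
    using mult_mat_vec_bounded[OF B] by blast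
  have bdd: "bdd_above R"
  proof (rule bdd_aboveI)
    fix a assume "a \<in> R"
    then obtain x where x: "x \<in> carrier_vec n" "x \<bullet> x = 1" "a = x \<bullet> (B *\<^sub>v x)" by (auto simp: R_def)
    have "a\<^sup>2 \<le> C" using scalar_prod_Cauchy_Schwarz[of x n "B *\<^sub>v x"] C(2)[of x] x B by simp
    then show "a \<le> sqrt C" by (rule real_le_rsqrt)
  qed
  have uR: "u \<bullet> (B *\<^sub>v u) \<in> R" using u by (auto simp: R_def)
  \<comment> \<open>\<open>char_matrix B \<mu>\<close> is \<open>B - \<mu> I\<close>; the sign makes
    the form nonnegative.\<close>
  define P where "P = - char_matrix B \<mu>"
  have P: "P \<in> carrier_mat n n" using B by (simp add: P_def)
  have Pv: "P *\<^sub>v x = \<mu> \<cdot>\<^sub>v x - B *\<^sub>v x" if x: "x \<in> carrier_vec n" for x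
  proof -
    have "char_matrix B \<mu> *\<^sub>v x = B *\<^sub>v x + (- \<mu>) \<cdot>\<^sub>v x"
      using B x by (simp add: char_matrix_def add_mult_distrib_mat_vec[of _ n n] smult_mat_mult_vec[of _ n n])
    then show ?thesis using B x unfolding P_def
      by (subst uminus_mult_mat_vec) (auto simp: char_matrix_def)
  qed
  have Pq: "x \<bullet> (P *\<^sub>v y) = \<mu> * (x \<bullet> y) - x \<bullet> (B *\<^sub>v y)"
    if "x \<in> carrier_vec n" "y \<in> carrier_vec n" for x y
    using that B by (simp add: Pv scalar_prod_minus_distrib[of _ n])
  have le_mu: "x \<bullet> (B *\<^sub>v x) \<le> \<mu> * (x \<bullet> x)" if x: "x \<in> carrier_vec n" for x
  proof (cases "x \<bullet> x = 0")
    case True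
    then have "x = 0\<^sub>v n" using scalar_prod_self_eq_0_iff[OF x] by simp
    then show ?thesis using B by simp
  next
    case False
    define c where "c = 1 / sqrt (x \<bullet> x)"
    have p: "0 < x \<bullet> x" using False scalar_prod_self_nonneg[of x] by linarith
    have c: "c * c * (x \<bullet> x) = 1" using p by (simp add: c_def)
    have cx: "c \<cdot>\<^sub>v x \<in> carrier_vec n" using x by simp
    have "(c \<cdot>\<^sub>v x) \<bullet> (c \<cdot>\<^sub>v x) = 1" using x c by simp
    moreover have "(c \<cdot>\<^sub>v x) \<bullet> (B *\<^sub>v (c \<cdot>\<^sub>v x)) = c * c * (x \<bullet> (B *\<^sub>v x))"
      using mult_mat_vec[OF B x] B x by simp
    ultimately have "c * c * (x \<bullet> (B *\<^sub>v x)) \<in> R" 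
      using cx unfolding R_def mem_Collect_eq by (intro exI[of _ "c \<cdot>\<^sub>v x"]) simp
    then have "c * c * (x \<bullet> (B *\<^sub>v x)) \<le> \<mu>" unfolding \<mu>_def using bdd by (rule cSup_upper)
    then have "(x \<bullet> x) * (c * c * (x \<bullet> (B *\<^sub>v x))) \<le> (x \<bullet> x) * \<mu>" using p by (intro mult_left_mono) auto
    then have "(c * c * (x \<bullet> x)) * (x \<bullet> (B *\<^sub>v x)) \<le> (x \<bullet> x) * \<mu>" by (simp only: mult_ac)
    then show ?thesis unfolding c by (simp add: mult.commute)
  qed
  have "eigenvalue B \<mu>"
  proof (rule ccontr)
    assume "\<not> eigenvalue B \<mu>"
    then have "det (char_matrix B \<mu>) \<noteq> 0" using eigenvalue_det[OF B] by simp
    then have dP: "det P \<noteq> 0" using det_0_negate[of "char_matrix B \<mu>" n] B by (simp add: P_def)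
    obtain C1 where C1: "C1 > 0" "\<And>x. x \<in> carrier_vec n \<Longrightarrow> x \<bullet> x \<le> C1 * ((P *\<^sub>v x) \<bullet> (P *\<^sub>v x))"
      using invertible_mat_bounded_below[OF P dP] by blast
    obtain C2 where C2: "C2 > 0"
      "\<And>x. x \<in> carrier_vec n \<Longrightarrow> (P *\<^sub>v x) \<bullet> (P *\<^sub>v x) \<le> C2 * (x \<bullet> (P *\<^sub>v x))"
    proof (rule psd_form_bounded_below[OF P])
      fix x y :: "real vec" assume xy: "x \<in> carrier_vec n" "y \<in> carrier_vec n"
      show "x \<bullet> (P *\<^sub>v y) = y \<bullet> (P *\<^sub>v x)"
        using xy sym[OF xy] comm_scalar_prod[OF xy] by (simp add: Pq)
      show "0 \<le> x \<bullet> (P *\<^sub>v x)" using xy le_mu[OF xy(1)] by (simp add: Pq)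
    qed blast
    \<comment> \<open>The two bounds give
      \<open>1 \<le> C1 * C2 * (x \<bullet> (P *\<^sub>v x))\<close> on unit vectors, so a defect
      below \<open>1 / (C1 * C2 + 1)\<close> is contradictory.\<close>
    have "\<mu> - 1 / (C1 * C2 + 1) < Sup R" unfolding \<mu>_def using C1(1) C2(1) by (simp add: add_pos_pos)
    then obtain x where x: "x \<in> carrier_vec n" "x \<bullet> x = 1" "\<mu> - 1 / (C1 * C2 + 1) < x \<bullet> (B *\<^sub>v x)"
      using less_cSupD[of R] uR by (auto simp: R_def)
    have "1 \<le> C1 * ((P *\<^sub>v x) \<bullet> (P *\<^sub>v x))" using C1(2)[OF x(1)] x(2) by simp
    also have "\<dots> \<le> C1 * (C2 * (x \<bullet> (P *\<^sub>v x)))" using C2(2)[OF x(1)] C1(1) by simp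
    also have "\<dots> = (C1 * C2) * (\<mu> - x \<bullet> (B *\<^sub>v x))" using x by (simp add: Pq)
    also have "\<dots> \<le> (C1 * C2) * (1 / (C1 * C2 + 1))"
      using x(3) C1(1) C2(1) by (intro mult_left_mono) auto
    also have "\<dots> < 1" using C1(1) C2(1) by (simp add: field_simps add_pos_pos)
    finally show False by simp
  qed
  then have "\<mu> \<le> lambda_max B" unfolding lambda_max_def
    using finite_eigenvalues[OF B] by (intro Max_ge) auto
  moreover have "u \<bullet> (B *\<^sub>v u) \<le> \<mu>" unfolding \<mu>_def using uR bdd by (rule cSup_upper)
  ultimately show ?thesis by simp
qed

section \<open>Expansions in the eigenvectors of the data Gram matrix\<close>

lemma outer_carrier [simp]: "u \<in> carrier_vec m \<Longrightarrow> w \<in> carrier_vec d \<Longrightarrow> outer u w \<in> carrier_mat m d"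
  by (simp add: outer_def)

lemma outer_mult_vec:
  assumes "w \<in> carrier_vec d" "x \<in> carrier_vec d"
  shows "outer u w *\<^sub>v x = (w \<bullet> x) \<cdot>\<^sub>v u"
  using assms
  by (intro eq_vecI) (auto simp: outer_def scalar_prod_def sum_distrib_right sum_distrib_left mult_ac)

locale eigen_data =
  fixes X :: "real mat" and d n r :: nat and lam :: "nat \<Rightarrow> real" and v :: "nat \<Rightarrow> real vec"
  assumes X: "X \<in> carrier_mat d n"
    and v: "\<And>i. i \<in> {1..r} \<Longrightarrow> v i \<in> carrier_vec n"
    and orth: "\<And>i j. i \<in> {1..r} \<Longrightarrow> j \<in> {1..r} \<Longrightarrow> v i \<bullet> v j = (if i = j then 1 else 0)"
    and decomp: "\<And>i j. i < n \<Longrightarrow> j < n \<Longrightarrow>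
      (transpose_mat X * X) $$ (i, j) = (\<Sum>k\<in>{1..r}. lam k * v k $ i * v k $ j)"
begin

lemma XT: "transpose_mat X \<in> carrier_mat n d" using X by simp

lemma XX: "transpose_mat X * X \<in> carrier_mat n n" using X by simp

lemma XX_vec:
  assumes x: "x \<in> carrier_vec n"
  shows "(transpose_mat X * X) *\<^sub>v x = vec n (\<lambda>i. \<Sum>k\<in>{1..r}. lam k * (v k \<bullet> x) * v k $ i)"
proof (intro eq_vecI)
  fix i assume "i < dim_vec (vec n (\<lambda>i. \<Sum>k\<in>{1..r}. lam k * (v k \<bullet> x) * v k $ i))"
  then have i: "i < n" by simp
  have "(B *\<^sub>v x) $ i = (\<Sum>j\<in>{0..<n}. B $$ (i, j) * x $ j)" if "B \<in> carrier_mat n n" for B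
    using that i x by (simp add: scalar_prod_def)
  from this[OF XX] have "((transpose_mat X * X) *\<^sub>v x) $ i
      = (\<Sum>j\<in>{0..<n}. (transpose_mat X * X) $$ (i, j) * x $ j)" .
  also have "\<dots> = (\<Sum>j\<in>{0..<n}. \<Sum>k\<in>{1..r}. lam k * v k $ i * v k $ j * x $ j)"
    using i by (intro sum.cong refl) (simp add: decomp sum_distrib_right)
  also have "\<dots> = (\<Sum>k\<in>{1..r}. \<Sum>j\<in>{0..<n}. lam k * v k $ i * v k $ j * x $ j)"
    by (rule sum.swap)
  also have "\<dots> = (\<Sum>k\<in>{1..r}. lam k * (v k \<bullet> x) * v k $ i)"
    using x by (intro sum.cong refl) (simp add: scalar_prod_def sum_distrib_left sum_distrib_right mult_ac)
  finally show "((transpose_mat X * X) *\<^sub>v x) $ i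
      = vec n (\<lambda>i. \<Sum>k\<in>{1..r}. lam k * (v k \<bullet> x) * v k $ i) $ i" using i by simp
qed (use X in simp)

lemma XTX_v: "i \<in> {1..r} \<Longrightarrow> transpose_mat X *\<^sub>v (X *\<^sub>v v i) = lam i \<cdot>\<^sub>v v i"
proof -
  assume i: "i \<in> {1..r}"
  have "transpose_mat X *\<^sub>v (X *\<^sub>v v i) = (transpose_mat X * X) *\<^sub>v v i"
    using assoc_mult_mat_vec[OF XT X v[OF i]] by simp
  also have "\<dots> = lam i \<cdot>\<^sub>v v i"
    unfolding XX_vec[OF v[OF i]]
    using i v[OF i] by (intro eq_vecI) (simp_all add: orth if_distrib[of "\<lambda>x. _ * x"] 
        if_distrib[of "\<lambda>x. x * _"] cong: if_cong)
  finally show ?thesis .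
qed

lemma XT_scalar:
  "s \<in> carrier_vec d \<Longrightarrow> x \<in> carrier_vec n \<Longrightarrow> (transpose_mat X *\<^sub>v s) \<bullet> x = s \<bullet> (X *\<^sub>v x)"
  by (rule transpose_vec_mult_scalar[OF X])

lemma X_scalar:
  "s \<in> carrier_vec d \<Longrightarrow> x \<in> carrier_vec n \<Longrightarrow> (X *\<^sub>v x) \<bullet> s = x \<bullet> (transpose_mat X *\<^sub>v s)"
  using transpose_vec_mult_scalar[OF XT, of s x] by simp

lemma Xv: "i \<in> {1..r} \<Longrightarrow> X *\<^sub>v v i \<in> carrier_vec d" using X v by simp

lemma Xx_Xv: "i \<in> {1..r} \<Longrightarrow> x \<in> carrier_vec n \<Longrightarrow> (X *\<^sub>v x) \<bullet> (X *\<^sub>v v i) = lam i * (x \<bullet> v i)"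
  using X_scalar[OF Xv] XTX_v v by simp

lemma proj:
  fixes w :: "real vec"
  defines "p \<equiv> vec n (\<lambda>k. \<Sum>i\<in>{1..r}. (w \<bullet> v i) * v i $ k)"
  shows "x \<in> carrier_vec n \<Longrightarrow> p \<bullet> x = (\<Sum>i\<in>{1..r}. (w \<bullet> v i) * (x \<bullet> v i))"
proof -
  assume x: "x \<in> carrier_vec n"
  have "p \<bullet> x = (\<Sum>k\<in>{0..<n}. \<Sum>i\<in>{1..r}. (w \<bullet> v i) * v i $ k * x $ k)"
    using x by (auto simp: p_def scalar_prod_def sum_distrib_right intro!: sum.cong)
  also have "\<dots> = (\<Sum>i\<in>{1..r}. \<Sum>k\<in>{0..<n}. (w \<bullet> v i) * v i $ k * x $ k)" by (rule sum.swap)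
  also have "\<dots> = (\<Sum>i\<in>{1..r}. (w \<bullet> v i) * (x \<bullet> v i))"
  proof (intro sum.cong refl)
    fix i assume i: "i \<in> {1..r}"
    show "(\<Sum>k = 0..<n. (w \<bullet> v i) * v i $ k * x $ k) = (w \<bullet> v i) * (x \<bullet> v i)"
      unfolding comm_scalar_prod[OF x v[OF i]]
      using x by (simp add: scalar_prod_def[of "v i" x] sum_distrib_left mult_ac)
  qed
  finally show ?thesis .
qed

text \<open>The test vectors of the spectral norm range over the whole space, which the
  \<open>v i\<close> may fail to span, so for them only an inequality holds.\<close>

lemma Bessel:
  assumes x: "x \<in> carrier_vec n"
  shows "(\<Sum>i\<in>{1..r}. (x \<bullet> v i)\<^sup>2) \<le> x \<bullet> x"
proof -
  define p where "p = vec n (\<lambda>k. \<Sum>i\<in>{1..r}. (x \<bullet> v i) * v i $ k)"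
  have p: "p \<in> carrier_vec n" by (simp add: p_def)
  have px: "p \<bullet> x = (\<Sum>i\<in>{1..r}. (x \<bullet> v i)\<^sup>2)"
    unfolding p_def proj[OF x] by (simp add: power2_eq_square)
  have pv: "p \<bullet> v i = x \<bullet> v i" if "i \<in> {1..r}" for i
    unfolding p_def proj[OF v[OF that]] using that
    by (simp add: orth if_distrib[of "\<lambda>x. _ * x"] cong: if_cong)
  have pp: "p \<bullet> p = (\<Sum>i\<in>{1..r}. (x \<bullet> v i)\<^sup>2)"
  proof -
    have "p \<bullet> p = (\<Sum>i\<in>{1..r}. (x \<bullet> v i) * (p \<bullet> v i))"
      using proj[OF p, of x] unfolding p_def[symmetric] .
    then show ?thesis by (simp add: pv power2_eq_square)
  qed
  have "0 \<le> (x - p) \<bullet> (x - p)" by (rule scalar_prod_self_nonneg)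
  also have "\<dots> = x \<bullet> x - 2 * (p \<bullet> x) + p \<bullet> p"
    using x p comm_scalar_prod[OF x p]
    by (simp add: minus_scalar_prod_distrib[of _ n] scalar_prod_minus_distrib[of _ n])
  finally show ?thesis using px pp by simp
qed

text \<open>Equality holds on the range of the transpose of \<open>X\<close>. The remainder
  \<open>u\<close> of the projection is orthogonal to all \<open>v i\<close>, so the Gram matrix
  kills it and \<open>X\<close> does too; then \<open>u\<close> is orthogonal to the range, to its
  own projection part, and hence to itself.\<close>

lemma Parseval:
  assumes s: "s \<in> carrier_vec d" and w: "w = transpose_mat X *\<^sub>v s" and x: "x \<in> carrier_vec n"
  shows "w \<bullet> x = (\<Sum>i\<in>{1..r}. (w \<bullet> v i) * (x \<bullet> v i))"
proof -
  have wc: "w \<in> carrier_vec n" using s w X by simp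
  define p where "p = vec n (\<lambda>k. \<Sum>i\<in>{1..r}. (w \<bullet> v i) * v i $ k)"
  have p: "p \<in> carrier_vec n" by (simp add: p_def)
  have px: "p \<bullet> x = (\<Sum>i\<in>{1..r}. (w \<bullet> v i) * (x \<bullet> v i))" if "x \<in> carrier_vec n" for x
    unfolding p_def proj[OF that] by simp
  have pv: "p \<bullet> v i = w \<bullet> v i" if "i \<in> {1..r}" for i
    unfolding px[OF v[OF that]] using that
    by (simp add: orth if_distrib[of "\<lambda>x. _ * x"] cong: if_cong)
  define u where "u = w - p"
  have u: "u \<in> carrier_vec n" using wc p by (simp add: u_def)
  have uv: "u \<bullet> v i = 0" if "i \<in> {1..r}" for i
    using wc p v[OF that] pv[OF that] by (simp add: u_def minus_scalar_prod_distrib[of _ n])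
  have "(transpose_mat X * X) *\<^sub>v u = 0\<^sub>v n" unfolding XX_vec[OF u]
    using uv comm_scalar_prod[OF u v] by (intro eq_vecI) auto
  then have z: "transpose_mat X *\<^sub>v (X *\<^sub>v u) = 0\<^sub>v n"
    using assoc_mult_mat_vec[OF XT X u] by simp
  have Xu: "X *\<^sub>v u \<in> carrier_vec d" using X u by simp
  have "(X *\<^sub>v u) \<bullet> (X *\<^sub>v u) = 0" using X_scalar[OF Xu u] z u by simp
  then have "X *\<^sub>v u = 0\<^sub>v d" using scalar_prod_self_eq_0_iff[OF Xu] by simp
  then have "w \<bullet> u = 0" unfolding w using XT_scalar[OF s u] s by simp
  moreover have "p \<bullet> u = 0" unfolding px[OF u] using uv by simp
  ultimately have "u \<bullet> u = 0" using wc p u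
    by (simp add: u_def minus_scalar_prod_distrib[of w n p "w - p"])
  then have "u = 0\<^sub>v n" using scalar_prod_self_eq_0_iff[OF u] by simp
  then have "(w - p) \<bullet> x = 0" using x by (simp add: u_def)
  then have "w \<bullet> x = p \<bullet> x" using wc p x by (simp add: minus_scalar_prod_distrib[of _ n])
  then show ?thesis by (simp add: px[OF x])
qed

end

section \<open>One gradient step, expressed in eigencoordinates\<close>

text \<open>A snapshot of the network at one time, with \<open>A'\<close> and \<open>W'\<close> as
  the next iterate. The labels enter through \<open>s\<close>, the linear teacher, so residuals lie
  in the range where \<open>Parseval\<close> applies.\<close>

locale net_state = eigen_data +
  fixes Y s :: "real vec" and A :: "real vec" and W :: "real mat" and m :: nat and eta :: real
  assumes s: "s \<in> carrier_vec d" and Y: "Y = transpose_mat X *\<^sub>v s"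
    and A: "A \<in> carrier_vec m" and W: "W \<in> carrier_mat m d"
    and m_pos: "0 < m" and n_pos: "0 < n" and d_pos: "0 < d"
begin

abbreviation "F \<equiv> net_F X A W"
abbreviation "D \<equiv> resid X Y A W"
abbreviation "u i \<equiv> X *\<^sub>v v i"
abbreviation "al i \<equiv> W *\<^sub>v (X *\<^sub>v v i)"

definition c :: real where "c = 2 * eta / (real n * sqrt (real m))"
definition A' :: "real vec" where "A' = A - c \<cdot>\<^sub>v ((W * X) *\<^sub>v D)"
definition W' :: "real mat" where "W' = W - c \<cdot>\<^sub>m outer A (X *\<^sub>v D)"

lemma net_F_range:
  assumes B: "B \<in> carrier_vec m" and V: "V \<in> carrier_mat m d"
  shows "net_F X B V = transpose_mat X *\<^sub>v ((1 / sqrt (real m)) \<cdot>\<^sub>v (transpose_mat V *\<^sub>v B))"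
proof -
  have VT: "transpose_mat V \<in> carrier_mat d m" using V by simp
  then have "(transpose_mat X * transpose_mat V) *\<^sub>v B = transpose_mat X *\<^sub>v (transpose_mat V *\<^sub>v B)"
    using assoc_mult_mat_vec[OF XT VT B] by simp
  then show ?thesis using B mult_mat_vec[OF XT, of "transpose_mat V *\<^sub>v B"] VT
    by (simp add: net_F_def)
qed

lemma net_F_v:
  assumes B: "B \<in> carrier_vec m" and V: "V \<in> carrier_mat m d" and x: "x \<in> carrier_vec n"
  shows "sqrt (real m) * (net_F X B V \<bullet> x) = B \<bullet> (V *\<^sub>v (X *\<^sub>v x))"
proof -
  have VT: "transpose_mat V \<in> carrier_mat d m" using V by simp
  have Xx: "X *\<^sub>v x \<in> carrier_vec d" using X x by simp
  have VTB: "transpose_mat V *\<^sub>v B \<in> carrier_vec d" using VT B by simp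
  have "net_F X B V \<bullet> x = (1 / sqrt (real m)) * ((transpose_mat V *\<^sub>v B) \<bullet> (X *\<^sub>v x))"
    unfolding net_F_range[OF B V] using VTB x
    by (subst XT_scalar) (simp_all add: smult_scalar_prod_distrib[OF VTB Xx])
  also have "(transpose_mat V *\<^sub>v B) \<bullet> (X *\<^sub>v x) = B \<bullet> (V *\<^sub>v (X *\<^sub>v x))"
    using transpose_vec_mult_scalar[OF V Xx B] .
  finally show ?thesis using m_pos by simp
qed

lemma net_F_carrier: "B \<in> carrier_vec m \<Longrightarrow> V \<in> carrier_mat m d \<Longrightarrow> net_F X B V \<in> carrier_vec n"
  using net_F_range X by simp

lemma Y_carrier: "Y \<in> carrier_vec n" using Y X s by simp

lemma F: "F \<in> carrier_vec n" using net_F_carrier[OF A W] .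

lemma D: "D \<in> carrier_vec n" using F Y_carrier by (simp add: resid_def)

lemma D_range: obtains q where "q \<in> carrier_vec d" "D = transpose_mat X *\<^sub>v q"
proof -
  let ?p = "(1 / sqrt (real m)) \<cdot>\<^sub>v (transpose_mat W *\<^sub>v A)"
  have p: "?p \<in> carrier_vec d" using W A by simp
  have "D = transpose_mat X *\<^sub>v (?p - s)"
    unfolding resid_def net_F_range[OF A W] Y mult_minus_distrib_mat_vec[OF XT p s] ..
  moreover have "?p - s \<in> carrier_vec d" using s by (rule minus_carrier_vec[OF p])
  ultimately show thesis using that by blast
qed

lemma D_Parseval:
  assumes "x \<in> carrier_vec n"
  shows "D \<bullet> x = (\<Sum>i\<in>{1..r}. (D \<bullet> v i) * (x \<bullet> v i))"
  by (rule D_range) (rule Parseval[OF _ _ assms])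

lemma XD: "X *\<^sub>v D \<in> carrier_vec d" using X D by simp
lemma WXD: "(W * X) *\<^sub>v D \<in> carrier_vec m" using X D W by simp
lemma al: "i \<in> {1..r} \<Longrightarrow> al i \<in> carrier_vec m" using W Xv by simp
lemma A': "A' \<in> carrier_vec m" using A WXD by (simp add: A'_def)
lemma W': "W' \<in> carrier_mat m d" unfolding W'_def
  by (rule minus_carrier_mat[OF smult_carrier_mat[OF outer_carrier[OF A XD]]])

lemma WXD_scalar:
  assumes y: "y \<in> carrier_vec m"
  shows "((W * X) *\<^sub>v D) \<bullet> y = (\<Sum>i\<in>{1..r}. (D \<bullet> v i) * (al i \<bullet> y))"
proof -
  have WT: "transpose_mat W \<in> carrier_mat d m" using W by simp
  have Wy: "transpose_mat W *\<^sub>v y \<in> carrier_vec d" using WT y by simp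
  have XWy: "transpose_mat X *\<^sub>v (transpose_mat W *\<^sub>v y) \<in> carrier_vec n" using XT Wy by simp
  have key: "(W *\<^sub>v (X *\<^sub>v x)) \<bullet> y = x \<bullet> (transpose_mat X *\<^sub>v (transpose_mat W *\<^sub>v y))"
    if x: "x \<in> carrier_vec n" for x
  proof -
    have Xx: "X *\<^sub>v x \<in> carrier_vec d" using X x by simp
    have "(W *\<^sub>v (X *\<^sub>v x)) \<bullet> y = (X *\<^sub>v x) \<bullet> (transpose_mat W *\<^sub>v y)"
      using transpose_vec_mult_scalar[OF WT y Xx] by simp
    then show ?thesis using X_scalar[OF Wy x] by simp
  qed
  have "((W * X) *\<^sub>v D) \<bullet> y = D \<bullet> (transpose_mat X *\<^sub>v (transpose_mat W *\<^sub>v y))"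
    using key[OF D] assoc_mult_mat_vec[OF W X D] by simp
  also have "\<dots> = (\<Sum>i\<in>{1..r}. (D \<bullet> v i) * (al i \<bullet> y))"
    unfolding D_Parseval[OF XWy]
    by (intro sum.cong refl) (use key[OF v] comm_scalar_prod[OF XWy v] in simp)
  finally show ?thesis .
qed

lemma W'_u: assumes i: "i \<in> {1..r}" shows "W' *\<^sub>v u i = al i - (c * lam i * (D \<bullet> v i)) \<cdot>\<^sub>v A"
proof -
  have o: "outer A (X *\<^sub>v D) \<in> carrier_mat m d" by (rule outer_carrier[OF A XD])
  have "W' *\<^sub>v u i = al i - (c \<cdot>\<^sub>m outer A (X *\<^sub>v D)) *\<^sub>v u i"
    unfolding W'_def using o by (intro minus_mult_distrib_mat_vec[OF W _ Xv[OF i]]) simp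
  also have "(c \<cdot>\<^sub>m outer A (X *\<^sub>v D)) *\<^sub>v u i = c \<cdot>\<^sub>v ((lam i * (D \<bullet> v i)) \<cdot>\<^sub>v A)"
    using smult_mat_mult_vec[OF o Xv[OF i]] outer_mult_vec[OF XD Xv[OF i]] Xx_Xv[OF i D] by simp
  finally show ?thesis by (simp add: smult_smult_assoc mult.assoc)
qed

lemma F_al: "i \<in> {1..r} \<Longrightarrow> A \<bullet> al i = sqrt (real m) * (F \<bullet> v i)"
  using net_F_v[OF A W v] by simp

lemma al_F: "i \<in> {1..r} \<Longrightarrow> al i \<bullet> A = sqrt (real m) * (F \<bullet> v i)"
  using F_al comm_scalar_prod[OF A al] by simp

lemma c_sq: "c * c = 4 * eta\<^sup>2 / ((real n)\<^sup>2 * real m)" 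
  by (simp add: c_def power2_eq_square)

lemma c_sqrt: "c * sqrt (real m) = 2 * eta / real n"
  using m_pos by (simp add: c_def)

lemma c_div: "c / sqrt (real m) = 2 * eta / (real n * real m)"
  by (simp add: c_def)

lemma WXD_A: "((W * X) *\<^sub>v D) \<bullet> A = sqrt (real m) * (\<Sum>i\<in>{1..r}. (F \<bullet> v i) * (D \<bullet> v i))"
  unfolding WXD_scalar[OF A] sum_distrib_left by (intro sum.cong refl) (simp add: al_F)

lemma A'_sq: "A' \<bullet> A' = A \<bullet> A - (4 * eta / real n) * (\<Sum>i\<in>{1..r}. (F \<bullet> v i) * (D \<bullet> v i))
    + c * c * (((W * X) *\<^sub>v D) \<bullet> ((W * X) *\<^sub>v D))"
proof -
  have "A' \<bullet> A' = A \<bullet> A - 2 * c * (((W * X) *\<^sub>v D) \<bullet> A)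
      + c * c * (((W * X) *\<^sub>v D) \<bullet> ((W * X) *\<^sub>v D))"
    unfolding A'_def using A WXD comm_scalar_prod[OF A WXD]
    by (simp add: minus_scalar_prod_distrib[of _ m] scalar_prod_minus_distrib[of _ m] algebra_simps)
  also have "2 * c * (((W * X) *\<^sub>v D) \<bullet> A)
      = 2 * (c * sqrt (real m)) * (\<Sum>i\<in>{1..r}. (F \<bullet> v i) * (D \<bullet> v i))"
    by (simp add: WXD_A)
  finally show ?thesis unfolding c_sqrt by simp
qed

definition G :: "nat \<Rightarrow> nat \<Rightarrow> real" where "G i j = al i \<bullet> al j"

text \<open>The product of the two updates expands into the first-order Gram terms and one term in
  \<open>c * c\<close>. The latter is a multiple of the alignment of \<open>F\<close> with
  \<open>D\<close> and is the origin of the correction in \<open>gram_Mstar\<close>.\<close>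

lemma F'_v:
  assumes i: "i \<in> {1..r}"
  shows "net_F X A' W' \<bullet> v i = F \<bullet> v i
     - 2 * eta / (real n * real m) * lam i * (D \<bullet> v i) * (A \<bullet> A)
     - 2 * eta / (real n * real m) * (\<Sum>j\<in>{1..r}. (D \<bullet> v j) * G j i)
     + 4 * eta\<^sup>2 / ((real n)\<^sup>2 * real m) * lam i * (D \<bullet> v i) * (\<Sum>j\<in>{1..r}. (F \<bullet> v j) * (D \<bullet> v j))"
proof -
  let ?k = "c * lam i * (D \<bullet> v i)"
  have "sqrt (real m) * (net_F X A' W' \<bullet> v i) = A' \<bullet> (al i - ?k \<cdot>\<^sub>v A)"
    using net_F_v[OF A' W' v[OF i]] W'_u[OF i] by simp
  also have "\<dots> = A \<bullet> al i - ?k * (A \<bullet> A) - c * (((W * X) *\<^sub>v D) \<bullet> al i)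
      + c * ?k * (((W * X) *\<^sub>v D) \<bullet> A)"
    unfolding A'_def using A WXD al[OF i]
    by (simp add: minus_scalar_prod_distrib[of _ m] scalar_prod_minus_distrib[of _ m] algebra_simps)
  finally have "net_F X A' W' \<bullet> v i = (A \<bullet> al i - ?k * (A \<bullet> A) - c * (((W * X) *\<^sub>v D) \<bullet> al i)
      + c * ?k * (((W * X) *\<^sub>v D) \<bullet> A)) / sqrt (real m)" using m_pos by (simp add: field_simps)
  also have "\<dots> = F \<bullet> v i - (c / sqrt (real m)) * lam i * (D \<bullet> v i) * (A \<bullet> A)
      - (c / sqrt (real m)) * (((W * X) *\<^sub>v D) \<bullet> al i)
      + (c * c) * lam i * (D \<bullet> v i) * (\<Sum>j\<in>{1..r}. (F \<bullet> v j) * (D \<bullet> v j))"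
  proof -
    have "(sm * f - c * li * D * a - c * p + c * (c * li * D) * (sm * S)) / sm
        = f - (c / sm) * li * D * a - (c / sm) * p + (c * c) * li * D * S"
      if "sm \<noteq> 0" for sm f li D a p S :: real
      using that by (simp add: field_simps)
    then show ?thesis unfolding F_al[OF i] WXD_A using m_pos by simp
  qed
  finally show ?thesis unfolding c_div c_sq WXD_scalar[OF al[OF i]] G_def .
qed

lemma G'_eq:
  assumes i: "i \<in> {1..r}" and j: "j \<in> {1..r}"
  shows "(W' *\<^sub>v u i) \<bullet> (W' *\<^sub>v u j) = G i j
     - 2 * eta / real n * ((F \<bullet> v i) * (lam j * (D \<bullet> v j)) + lam i * (D \<bullet> v i) * (F \<bullet> v j))
     + 4 * eta\<^sup>2 / ((real n)\<^sup>2 * real m) * (A \<bullet> A) * (lam i * (D \<bullet> v i)) * (lam j * (D \<bullet> v j))"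
proof -
  have "(W' *\<^sub>v u i) \<bullet> (W' *\<^sub>v u j) = G i j
     - c * sqrt (real m) * ((F \<bullet> v i) * (lam j * (D \<bullet> v j)) + lam i * (D \<bullet> v i) * (F \<bullet> v j))
     + c * c * (A \<bullet> A) * (lam i * (D \<bullet> v i)) * (lam j * (D \<bullet> v j))"
    unfolding W'_u[OF i] W'_u[OF j] G_def using A al[OF i] al[OF j] F_al[OF j] al_F[OF i]
    by (simp add: minus_scalar_prod_distrib[of _ m] scalar_prod_minus_distrib[of _ m] algebra_simps)
  then show ?thesis unfolding c_sqrt c_sq .
qed

lemma quad_W:
  assumes x: "x \<in> carrier_vec n"
  shows "(transpose_mat X * transpose_mat W * W * X) *\<^sub>v x
    = transpose_mat X *\<^sub>v (transpose_mat W *\<^sub>v (W *\<^sub>v (X *\<^sub>v x)))"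
proof -
  have WT: "transpose_mat W \<in> carrier_mat d m" using W by simp
  have XW: "transpose_mat X * transpose_mat W \<in> carrier_mat n m" using XT WT by simp
  have XWW: "transpose_mat X * transpose_mat W * W \<in> carrier_mat n d" using XW W by simp
  have Xx: "X *\<^sub>v x \<in> carrier_vec d" using X x by simp
  have WXx: "W *\<^sub>v (X *\<^sub>v x) \<in> carrier_vec m" using W Xx by simp
  show ?thesis
    unfolding assoc_mult_mat_vec[OF XWW X x] assoc_mult_mat_vec[OF XW W Xx]
      assoc_mult_mat_vec[OF XT WT WXx] ..
qed

lemma quad_W_form:
  assumes x: "x \<in> carrier_vec n" and y: "y \<in> carrier_vec n"
  shows "y \<bullet> ((transpose_mat X * transpose_mat W * W * X) *\<^sub>v x)
    = (W *\<^sub>v (X *\<^sub>v y)) \<bullet> (W *\<^sub>v (X *\<^sub>v x))"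
proof -
  have WT: "transpose_mat W \<in> carrier_mat d m" using W by simp
  have Xx: "X *\<^sub>v x \<in> carrier_vec d" "X *\<^sub>v y \<in> carrier_vec d" using X x y by auto
  have WXx: "W *\<^sub>v (X *\<^sub>v x) \<in> carrier_vec m" using W Xx by simp
  have t: "transpose_mat W *\<^sub>v (W *\<^sub>v (X *\<^sub>v x)) \<in> carrier_vec d" using WT WXx by simp
  have "y \<bullet> ((transpose_mat X * transpose_mat W * W * X) *\<^sub>v x)
      = (X *\<^sub>v y) \<bullet> (transpose_mat W *\<^sub>v (W *\<^sub>v (X *\<^sub>v x)))"
    unfolding quad_W[OF x] using X_scalar[OF t y] by simp
  also have "\<dots> = (W *\<^sub>v (X *\<^sub>v y)) \<bullet> (W *\<^sub>v (X *\<^sub>v x))"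
    using transpose_vec_mult_scalar[OF WT WXx Xx(2)] by simp
  finally show ?thesis .
qed

lemma quad_X_form:
  assumes x: "x \<in> carrier_vec n" and y: "y \<in> carrier_vec n"
  shows "y \<bullet> ((transpose_mat X * X) *\<^sub>v x) = (X *\<^sub>v y) \<bullet> (X *\<^sub>v x)"
proof -
  have Xx: "X *\<^sub>v x \<in> carrier_vec d" using X x by simp
  show ?thesis unfolding assoc_mult_mat_vec[OF XT X x] using X_scalar[OF Xx y] by simp
qed

abbreviation "XWWX \<equiv> transpose_mat X * transpose_mat W * W * X"
abbreviation "XtX \<equiv> transpose_mat X * X"

lemma XWWX: "XWWX \<in> carrier_mat n n"
proof -
  have "transpose_mat W \<in> carrier_mat d m" using W by simp
  from mult_carrier_mat[OF mult_carrier_mat[OF mult_carrier_mat[OF XT this] W] X] show ?thesis .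
qed

lemma Gamma_carrier: "gram_Gamma X A W \<in> carrier_mat n n"
  unfolding gram_Gamma_def Let_def
  by (intro smult_carrier_mat minus_carrier_mat XX)

lemma Gamma_vec:
  assumes x: "x \<in> carrier_vec n"
  shows "gram_Gamma X A W *\<^sub>v x
    = (2 / (real m * real n)) \<cdot>\<^sub>v (XWWX *\<^sub>v x - (real m / real d) \<cdot>\<^sub>v (XtX *\<^sub>v x))"
proof -
  have k: "(real m / real d) \<cdot>\<^sub>m XtX \<in> carrier_mat n n" using XX by simp
  have "(XWWX - (real m / real d) \<cdot>\<^sub>m XtX) *\<^sub>v x = XWWX *\<^sub>v x - (real m / real d) \<cdot>\<^sub>v (XtX *\<^sub>v x)"
    using minus_mult_distrib_mat_vec[OF XWWX k x] smult_mat_mult_vec[OF XX x] by simp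
  moreover have "XWWX - (real m / real d) \<cdot>\<^sub>m XtX \<in> carrier_mat n n" using k by (rule minus_carrier_mat)
  ultimately show ?thesis using X A smult_mat_mult_vec[of _ n n x] x
    by (simp add: gram_Gamma_def Let_def)
qed

lemma Gamma_form:
  assumes x: "x \<in> carrier_vec n" and y: "y \<in> carrier_vec n"
  shows "y \<bullet> (gram_Gamma X A W *\<^sub>v x) = 2 / (real m * real n)
    * ((W *\<^sub>v (X *\<^sub>v y)) \<bullet> (W *\<^sub>v (X *\<^sub>v x)) - real m / real d * ((X *\<^sub>v y) \<bullet> (X *\<^sub>v x)))"
proof -
  have c: "XWWX *\<^sub>v x \<in> carrier_vec n" "XtX *\<^sub>v x \<in> carrier_vec n" using XWWX XX x by auto
  show ?thesis unfolding Gamma_vec[OF x] using c y quad_W_form[OF x y] quad_X_form[OF x y]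
    by (simp add: scalar_prod_minus_distrib[of _ n])
qed

lemma Gamma_range:
  assumes x: "x \<in> carrier_vec n"
  obtains q where "q \<in> carrier_vec d" "gram_Gamma X A W *\<^sub>v x = transpose_mat X *\<^sub>v q"
proof -
  have WT: "transpose_mat W \<in> carrier_mat d m" using W by simp
  have Xx: "X *\<^sub>v x \<in> carrier_vec d" using X x by simp
  let ?p = "transpose_mat W *\<^sub>v (W *\<^sub>v (X *\<^sub>v x))"
  let ?q = "(real m / real d) \<cdot>\<^sub>v (X *\<^sub>v x)"
  have p: "?p \<in> carrier_vec d" using WT W Xx by simp
  have q: "?q \<in> carrier_vec d" using Xx by simp
  show thesis
  proof (rule that[of "(2 / (real m * real n)) \<cdot>\<^sub>v (?p - ?q)"])
    show "(2 / (real m * real n)) \<cdot>\<^sub>v (?p - ?q) \<in> carrier_vec d" using p q by simp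
    show "gram_Gamma X A W *\<^sub>v x = transpose_mat X *\<^sub>v ((2 / (real m * real n)) \<cdot>\<^sub>v (?p - ?q))"
      unfolding Gamma_vec[OF x] quad_W[OF x] assoc_mult_mat_vec[OF XT X x]
      using p q Xx mult_mat_vec[OF XT, of "?p - ?q"] mult_minus_distrib_mat_vec[OF XT p q]
        mult_mat_vec[OF XT Xx] by simp
  qed
qed

definition Gam :: "nat \<Rightarrow> nat \<Rightarrow> real" where "Gam i j = v i \<bullet> (gram_Gamma X A W *\<^sub>v v j)"

lemma Gam_eq:
  assumes "i \<in> {1..r}" "j \<in> {1..r}"
  shows "Gam i j = 2 / (real m * real n) * (G i j - real m / real d * (if i = j then lam i else 0))"
  unfolding Gam_def Gamma_form[OF v[OF assms(2)] v[OF assms(1)]] G_def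
  using Xx_Xv[OF assms(2) v[OF assms(1)]] orth[OF assms] by simp

lemma Gam_commute: "i \<in> {1..r} \<Longrightarrow> j \<in> {1..r} \<Longrightarrow> Gam i j = Gam j i"
  using comm_scalar_prod[OF al al] by (auto simp: Gam_eq G_def)

text \<open>The image of any vector under \<open>gram_Gamma\<close> lies in the range of the
  transpose of \<open>X\<close>, so its norm is the norm of its coordinates. These are tested
  against themselves, and \<open>Bessel\<close> bounds the coordinates of \<open>x\<close>.\<close>

lemma Gamma_vec_norm_le:
  assumes x: "x \<in> carrier_vec n" "x \<bullet> x = 1" and g0: "0 \<le> g"
    and g: "\<And>y x. \<bar>\<Sum>i\<in>{1..r}. y i * (\<Sum>j\<in>{1..r}. Gam i j * x j)\<bar>
      \<le> g * (L2_set y {1..r} * L2_set x {1..r})"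
  shows "vnorm (gram_Gamma X A W *\<^sub>v x) \<le> g"
proof -
  define w where "w = gram_Gamma X A W *\<^sub>v x"
  have w: "w \<in> carrier_vec n" using Gamma_carrier x by (simp add: w_def)
  have wv: "w \<bullet> v i = (\<Sum>j\<in>{1..r}. Gam i j * (x \<bullet> v j))" if i: "i \<in> {1..r}" for i
  proof -
    obtain q where q: "q \<in> carrier_vec d" "gram_Gamma X A W *\<^sub>v v i = transpose_mat X *\<^sub>v q"
      using Gamma_range[OF v[OF i]] by blast
    have gi: "gram_Gamma X A W *\<^sub>v v i \<in> carrier_vec n" using Gamma_carrier v[OF i] by simp
    have Wc: "W *\<^sub>v (X *\<^sub>v y) \<in> carrier_vec m" "X *\<^sub>v y \<in> carrier_vec d" if "y \<in> carrier_vec n" for y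
      using W X that by auto
    have "w \<bullet> v i = v i \<bullet> w" using comm_scalar_prod[OF w v[OF i]] .
    also have "\<dots> = x \<bullet> (gram_Gamma X A W *\<^sub>v v i)"
      unfolding w_def Gamma_form[OF x(1) v[OF i]] Gamma_form[OF v[OF i] x(1)]
      using comm_scalar_prod[OF Wc(1)[OF x(1)] Wc(1)[OF v[OF i]]]
        comm_scalar_prod[OF Wc(2)[OF x(1)] Wc(2)[OF v[OF i]]] by simp
    also have "\<dots> = (gram_Gamma X A W *\<^sub>v v i) \<bullet> x" using comm_scalar_prod[OF x(1) gi] .
    also have "\<dots> = (\<Sum>j\<in>{1..r}. ((gram_Gamma X A W *\<^sub>v v i) \<bullet> v j) * (x \<bullet> v j))"
      by (rule Parseval[OF q x(1)])
    also have "\<dots> = (\<Sum>j\<in>{1..r}. Gam i j * (x \<bullet> v j))"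
    proof (intro sum.cong refl)
      fix j assume j: "j \<in> {1..r}"
      show "((gram_Gamma X A W *\<^sub>v v i) \<bullet> v j) * (x \<bullet> v j) = Gam i j * (x \<bullet> v j)"
        using Gam_commute[OF i j] comm_scalar_prod[OF gi v[OF j]] by (simp add: Gam_def)
    qed
    finally show ?thesis .
  qed
  define y where "y i = w \<bullet> v i" for i
  obtain q where q: "q \<in> carrier_vec d" "w = transpose_mat X *\<^sub>v q"
    using Gamma_range[OF x(1)] unfolding w_def by blast
  have ww: "w \<bullet> w = (\<Sum>i\<in>{1..r}. y i * y i)" using Parseval[OF q w] by (simp add: y_def)
  have L: "L2_set y {1..r} = vnorm w" by (simp add: L2_set_def vnorm_def ww power2_eq_square)
  have "(\<Sum>i\<in>{1..r}. y i * y i) = (\<Sum>i\<in>{1..r}. y i * (\<Sum>j\<in>{1..r}. Gam i j * (x \<bullet> v j)))"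
    by (intro sum.cong refl) (use wv in \<open>simp add: y_def\<close>)
  also have "\<dots> \<le> g * (L2_set y {1..r} * L2_set (\<lambda>j. x \<bullet> v j) {1..r})"
    using g[of y "\<lambda>j. x \<bullet> v j"] by linarith
  also have "\<dots> \<le> g * (L2_set y {1..r} * 1)"
  proof -
    have "L2_set (\<lambda>j. x \<bullet> v j) {1..r} \<le> sqrt 1"
      unfolding L2_set_def using Bessel[OF x(1)] x(2) by (intro real_sqrt_le_mono) simp
    then show ?thesis using g0 by (intro mult_left_mono) (auto simp: L2_set_nonneg)
  qed
  finally have "L2_set y {1..r} \<le> g" using g0 by (intro L2_set_le_of_self_pairing) auto
  then show ?thesis unfolding L w_def .
qed

lemma spec_norm_Gamma_le:
  assumes "0 \<le> g" and "\<And>y x. \<bar>\<Sum>i\<in>{1..r}. y i * (\<Sum>j\<in>{1..r}. Gam i j * x j)\<bar>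
      \<le> g * (L2_set y {1..r} * L2_set x {1..r})"
  shows "spec_norm (gram_Gamma X A W) \<le> g"
  unfolding spec_norm_def
proof (rule cSup_least)
  have "unit_vec n 0 \<in> carrier_vec (dim_col (gram_Gamma X A W))" using Gamma_carrier by simp
  moreover have "vnorm (unit_vec n 0) = 1" using n_pos by (simp add: vnorm_def)
  ultimately show "{vnorm (gram_Gamma X A W *\<^sub>v x) |x.
      x \<in> carrier_vec (dim_col (gram_Gamma X A W)) \<and> vnorm x = 1} \<noteq> {}" by blast
next
  fix k assume "k \<in> {vnorm (gram_Gamma X A W *\<^sub>v x) |x.
      x \<in> carrier_vec (dim_col (gram_Gamma X A W)) \<and> vnorm x = 1}"
  then obtain x where "x \<in> carrier_vec n" "vnorm x = 1" "k = vnorm (gram_Gamma X A W *\<^sub>v x)"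
    using Gamma_carrier by auto
  then show "k \<le> g" using Gamma_vec_norm_le[of x g] assms by (simp add: vnorm_def)
qed

lemma M_carrier: "gram_M X A W \<in> carrier_mat n n"
  unfolding gram_M_def Let_def
  by (intro smult_carrier_mat add_carrier_mat XWWX)

lemma M_form:
  assumes x: "x \<in> carrier_vec n" and y: "y \<in> carrier_vec n"
  shows "y \<bullet> (gram_M X A W *\<^sub>v x) = 2 / (real m * real n)
    * ((A \<bullet> A) * ((X *\<^sub>v y) \<bullet> (X *\<^sub>v x)) + (W *\<^sub>v (X *\<^sub>v y)) \<bullet> (W *\<^sub>v (X *\<^sub>v x)))"
proof -
  have k: "(A \<bullet> A) \<cdot>\<^sub>m XtX \<in> carrier_mat n n" using XX by simp
  have kk: "(A \<bullet> A) \<cdot>\<^sub>m XtX + XWWX \<in> carrier_mat n n" using XWWX by (rule add_carrier_mat)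
  have c: "XWWX *\<^sub>v x \<in> carrier_vec n" "XtX *\<^sub>v x \<in> carrier_vec n" using XWWX XX x by auto
  have "gram_M X A W *\<^sub>v x = (2 / (real m * real n)) \<cdot>\<^sub>v ((A \<bullet> A) \<cdot>\<^sub>v (XtX *\<^sub>v x) + XWWX *\<^sub>v x)"
    using add_mult_distrib_mat_vec[OF k XWWX x] smult_mat_mult_vec[OF XX x]
      smult_mat_mult_vec[OF kk x] X A by (simp add: gram_M_def Let_def)
  then show ?thesis using c y quad_W_form[OF x y] quad_X_form[OF x y]
    by (simp add: scalar_prod_add_distrib[of _ n])
qed

lemma Mstar_carrier: "gram_Mstar eta X Y A W \<in> carrier_mat n n"
  unfolding gram_Mstar_def Let_def by (intro smult_carrier_mat minus_carrier_mat XX)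

lemma Mstar_form:
  assumes x: "x \<in> carrier_vec n" and y: "y \<in> carrier_vec n"
  shows "y \<bullet> (gram_Mstar eta X Y A W *\<^sub>v x) = y \<bullet> (gram_M X A W *\<^sub>v x)
    - 4 * eta / ((real n)\<^sup>2 * real m) * (D \<bullet> F) * ((X *\<^sub>v y) \<bullet> (X *\<^sub>v x))"
proof -
  let ?k = "4 * eta / ((real n)\<^sup>2 * real m) * (D \<bullet> F)"
  have k: "?k \<cdot>\<^sub>m XtX \<in> carrier_mat n n" using XX by simp
  have c: "gram_M X A W *\<^sub>v x \<in> carrier_vec n" "XtX *\<^sub>v x \<in> carrier_vec n"
    using M_carrier XX x by auto
  have "gram_Mstar eta X Y A W *\<^sub>v x = gram_M X A W *\<^sub>v x - ?k \<cdot>\<^sub>v (XtX *\<^sub>v x)"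
    using minus_mult_distrib_mat_vec[OF M_carrier k x] smult_mat_mult_vec[OF XX x] X A
    by (simp add: gram_Mstar_def Let_def)
  then show ?thesis using c y quad_X_form[OF x y] by (simp add: scalar_prod_minus_distrib[of _ n])
qed

text \<open>Translates the stopping rule into a scalar inequality for one eigencoordinate.\<close>

lemma Mstar_le_lambda_max:
  assumes "i \<in> {1..r}"
  shows "v i \<bullet> (gram_Mstar eta X Y A W *\<^sub>v v i) \<le> lambda_max (gram_Mstar eta X Y A W)"
proof (rule Rayleigh_le_lambda_max[OF Mstar_carrier])
  fix x y :: "real vec" assume xy: "x \<in> carrier_vec n" "y \<in> carrier_vec n"
  have Wc: "W *\<^sub>v (X *\<^sub>v y) \<in> carrier_vec m" "X *\<^sub>v y \<in> carrier_vec d" if "y \<in> carrier_vec n" for y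
    using W X that by auto
  show "x \<bullet> (gram_Mstar eta X Y A W *\<^sub>v y) = y \<bullet> (gram_Mstar eta X Y A W *\<^sub>v x)"
    unfolding Mstar_form[OF xy] Mstar_form[OF xy(2,1)] M_form[OF xy] M_form[OF xy(2,1)]
    using comm_scalar_prod[OF Wc(1)[OF xy(1)] Wc(1)[OF xy(2)]]
      comm_scalar_prod[OF Wc(2)[OF xy(1)] Wc(2)[OF xy(2)]] by simp
qed (use v orth assms in auto)

lemma DF: "D \<bullet> F = (\<Sum>i\<in>{1..r}. (F \<bullet> v i) * (D \<bullet> v i))"
  unfolding D_Parseval[OF F] by (simp add: mult.commute)

lemma M_v: "i \<in> {1..r} \<Longrightarrow> v i \<bullet> (gram_M X A W *\<^sub>v v i)
    = 2 / (real m * real n) * ((A \<bullet> A) * lam i + G i i)"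
  using M_form[OF v v] Xx_Xv[OF _ v] orth by (simp add: G_def)

lemma Mstar_v: "i \<in> {1..r} \<Longrightarrow> v i \<bullet> (gram_Mstar eta X Y A W *\<^sub>v v i)
    = 2 / (real m * real n) * ((A \<bullet> A) * lam i + G i i)
      - 4 * eta / ((real n)\<^sup>2 * real m) * (\<Sum>i\<in>{1..r}. (F \<bullet> v i) * (D \<bullet> v i)) * lam i"
  using Mstar_form[OF v v] Xx_Xv[OF _ v] orth M_v DF by simp

text \<open>The scalar \<open>\<gamma>\<close> with \<open>M\<^sup>* - \<Gamma> = \<gamma> X\<^sup>T X\<close>, multiplied by \<open>n\<close>.\<close>
definition gam :: real where
  "gam = 2 * ((A \<bullet> A) / real m + 1 / real d)
    - 4 * eta / (real m * real n) * (\<Sum>i\<in>{1..r}. (F \<bullet> v i) * (D \<bullet> v i))"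

lemma Mstar_v_gam:
  assumes i: "i \<in> {1..r}"
  shows "eta * (v i \<bullet> (gram_Mstar eta X Y A W *\<^sub>v v i)) = gam * (eta * lam i / real n) + eta * Gam i i"
proof -
  let ?S = "\<Sum>i\<in>{1..r}. (F \<bullet> v i) * (D \<bullet> v i)"
  have "eta * (2 / (real m * real n) * (a * li + g) - 4 * eta / ((real n)\<^sup>2 * real m) * S * li)
     = (2 * (a / real m + 1 / real d) - 4 * eta / (real m * real n) * S) * (eta * li / real n)
       + eta * (2 / (real m * real n) * (g - real m / real d * li))" for a li g S :: real
    using m_pos n_pos d_pos by (simp add: field_simps power2_eq_square)
  then show ?thesis unfolding Mstar_v[OF i] Gam_eq[OF i i] gam_def by simp
qed

text \<open>The multiple \<open>m / d\<close> subtracted in \<open>gram_Gamma\<close> is returned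
  through the summand \<open>1 / d\<close> in \<open>gam\<close>, so the split into a diagonal part
  and a \<open>Gam\<close> part is exact.\<close>

lemma D_step:
  assumes i: "i \<in> {1..r}"
  shows "resid X Y A' W' \<bullet> v i = (1 - gam * (eta * lam i / real n)) * (D \<bullet> v i)
    - (\<Sum>j\<in>{1..r}. eta * Gam i j * (D \<bullet> v j))"
proof -
  let ?S = "\<Sum>i\<in>{1..r}. (F \<bullet> v i) * (D \<bullet> v i)"
  let ?P = "\<Sum>j\<in>{1..r}. (D \<bullet> v j) * G j i"
  let ?e = "2 / (real m * real n)"
  have F': "net_F X A' W' \<in> carrier_vec n" by (rule net_F_carrier[OF A' W'])
  have "resid X Y A' W' \<bullet> v i - D \<bullet> v i = net_F X A' W' \<bullet> v i - F \<bullet> v i"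
    using F F' Y_carrier v[OF i] by (simp add: resid_def minus_scalar_prod_distrib[of _ n])
  moreover have "(\<Sum>j\<in>{1..r}. eta * Gam i j * (D \<bullet> v j))
      = eta * ?e * (?P - real m / real d * lam i * (D \<bullet> v i))"
  proof -
    have "(\<Sum>j\<in>{1..r}. eta * Gam i j * (D \<bullet> v j))
       = (\<Sum>j\<in>{1..r}. eta * ?e * ((D \<bullet> v j) * G j i)
           - (if i = j then eta * ?e * (real m / real d * lam i * (D \<bullet> v i)) else 0))"
      by (intro sum.cong refl)
        (use i comm_scalar_prod[OF al al] in \<open>simp add: Gam_eq G_def algebra_simps\<close>)
    also have "\<dots> = eta * ?e * ?P - eta * ?e * (real m / real d * lam i * (D \<bullet> v i))"
      unfolding sum_subtractf sum_distrib_left using i by simp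
    finally show ?thesis by (simp add: algebra_simps)
  qed
  moreover have "- 2 * eta / (real n * real m) * li * D * a - 2 * eta / (real n * real m) * P
        + 4 * eta\<^sup>2 / ((real n)\<^sup>2 * real m) * li * D * S
     = - ((2 * (a / real m + 1 / real d) - 4 * eta / (real m * real n) * S) * (eta * li / real n)) * D
       - eta * ?e * (P - real m / real d * li * D)" for li D a P S :: real
    using m_pos n_pos d_pos by (simp add: field_simps power2_eq_square)
  from this[of "lam i" "D \<bullet> v i" "A \<bullet> A" ?P ?S]
  have "net_F X A' W' \<bullet> v i - F \<bullet> v i = - (gam * (eta * lam i / real n)) * (D \<bullet> v i)
       - eta * ?e * (?P - real m / real d * lam i * (D \<bullet> v i))"
    unfolding F'_v[OF i] gam_def by simp
  ultimately show ?thesis by (simp add: algebra_simps)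
qed


text \<open>The subtracted diagonal is constant in time, so the increment is that of the products
  \<open>G\<close>. The left side is the coefficient of the next iterate written out in terms of
  \<open>W'\<close>.\<close>

lemma Gam_step:
  assumes i: "i \<in> {1..r}" and j: "j \<in> {1..r}"
  defines "w \<equiv> 4 * (eta / real m) / real n"
  shows "eta * (2 / (real m * real n) * ((W' *\<^sub>v u i) \<bullet> (W' *\<^sub>v u j)
      - real m / real d * (if i = j then lam i else 0)))
    = eta * Gam i j
      - w * ((F \<bullet> v i) * (eta * lam j / real n * (D \<bullet> v j))
        + (eta * lam i / real n * (D \<bullet> v i)) * (F \<bullet> v j))
      + 2 * w * ((A \<bullet> A) / real m) * (eta * lam i / real n * (D \<bullet> v i)) * (eta * lam j / real n * (D \<bullet> v j))"
proof -
  have "eta * (2 / (real m * real n) * (g - 2 * eta / real n * (fi * (lj * Dj) + li * Di * fj)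
       + 4 * eta\<^sup>2 / ((real n)\<^sup>2 * real m) * a * (li * Di) * (lj * Dj) - k))
     = eta * (2 / (real m * real n) * (g - k))
      - w * (fi * (eta * lj / real n * Dj) + (eta * li / real n * Di) * fj)
      + 2 * w * (a / real m) * (eta * li / real n * Di) * (eta * lj / real n * Dj)"
    for g fi fj li lj Di Dj a k :: real
    using m_pos n_pos by (simp add: w_def field_simps power2_eq_square)
  then show ?thesis unfolding G'_eq[OF i j] Gam_eq[OF i j] .
qed

text \<open>The first-order change of \<open>\<parallel>A\<parallel>\<^sup>2\<close> contributes the
  full alignment and that of \<open>G i i\<close> the i-th summand once more, both with factor
  \<open>- 4 * eta / n * lam i\<close>; the second-order terms are nonnegative.\<close>

lemma sharpness_step:
  assumes i: "i \<in> {1..r}" and eta: "0 < eta" and lam: "0 < lam i"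
    and neg: "(\<Sum>j\<in>{1..r}. (F \<bullet> v j) * (D \<bullet> v j)) + (F \<bullet> v i) * (D \<bullet> v i) < 0"
  shows "2 / (real m * real n) * ((A \<bullet> A) * lam i + G i i)
    < 2 / (real m * real n) * ((A' \<bullet> A') * lam i + (W' *\<^sub>v u i) \<bullet> (W' *\<^sub>v u i))"
proof -
  let ?S = "\<Sum>j\<in>{1..r}. (F \<bullet> v j) * (D \<bullet> v j)"
  let ?Q = "((W * X) *\<^sub>v D) \<bullet> ((W * X) *\<^sub>v D)"
  have "0 < - (4 * eta / real n) * lam i * (?S + (F \<bullet> v i) * (D \<bullet> v i))"
  proof -
    have "(4 * eta / real n * lam i) * (?S + (F \<bullet> v i) * (D \<bullet> v i)) < 0"
      by (rule mult_pos_neg[OF _ neg]) (use eta lam n_pos in simp)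
    then show ?thesis by (simp only: mult_minus_left neg_0_less_iff_less minus_divide_left[symmetric])
  qed
  moreover have "0 \<le> c * c * ?Q * lam i" using lam scalar_prod_self_nonneg by simp
  moreover have "0 \<le> 4 * eta\<^sup>2 / ((real n)\<^sup>2 * real m) * (A \<bullet> A) * (lam i * (D \<bullet> v i)) * (lam i * (D \<bullet> v i))"
  proof -
    have "0 \<le> 4 * eta\<^sup>2 / ((real n)\<^sup>2 * real m) * (A \<bullet> A)"
      using scalar_prod_self_nonneg[of A] by (intro mult_nonneg_nonneg) auto
    from mult_nonneg_nonneg[OF this zero_le_square[of "lam i * (D \<bullet> v i)"]]
    show ?thesis by (simp only: mult.assoc)
  qed
  moreover have "(A' \<bullet> A') * lam i + (W' *\<^sub>v u i) \<bullet> (W' *\<^sub>v u i) - ((A \<bullet> A) * lam i + G i i)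
     = - (4 * eta / real n) * lam i * (?S + (F \<bullet> v i) * (D \<bullet> v i)) + c * c * ?Q * lam i
      + 4 * eta\<^sup>2 / ((real n)\<^sup>2 * real m) * (A \<bullet> A) * (lam i * (D \<bullet> v i)) * (lam i * (D \<bullet> v i))"
    unfolding A'_sq G'_eq[OF i i] by (simp add: algebra_simps)
  ultimately have "(A \<bullet> A) * lam i + G i i < (A' \<bullet> A') * lam i + (W' *\<^sub>v u i) \<bullet> (W' *\<^sub>v u i)"
    by linarith
  then show ?thesis using m_pos n_pos by (simp add: divide_strict_right_mono)
qed

end

section \<open>Consequences of the symmetric initialization\<close>

lemma sum_lessThan_double: "(\<Sum>q<2 * h. f q) = (\<Sum>q<h. f q + f (q + h))"
  for f :: "nat \<Rightarrow> 'a :: comm_monoid_add"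
proof -
  have "(\<Sum>q<2 * h. f q) = (\<Sum>q\<in>{0..<h}. f q) + (\<Sum>q\<in>{h..<h + h}. f q)"
    by (simp add: sum.atLeastLessThan_concat lessThan_atLeast0 mult_2)
  also have "(\<Sum>q\<in>{h..<h + h}. f q) = (\<Sum>q\<in>{0..<h}. f (q + h))"
    using sum.shift_bounds_nat_ivl[of f 0 h h] by simp
  finally show ?thesis by (simp add: sum.distrib lessThan_atLeast0)
qed

context
  fixes m d :: nat and A :: "real vec" and W :: "real mat"
  assumes m: "even m" and A: "A \<in> carrier_vec m" and W: "W \<in> carrier_mat m d"
    and sym: "\<forall>q<m div 2. (A $ q = 1 \<or> A $ q = -1) \<and> A $ (q + m div 2) = - A $ q \<and>
                    row W (q + m div 2) = row W q"
begin

lemma m_double: "m = 2 * (m div 2)" using m by simp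

text \<open>Neurons \<open>q\<close> and \<open>q + m div 2\<close> share their input weights and
  have opposite output signs, so they cancel.\<close>

lemma symmetric_init_output: "A \<bullet> (W *\<^sub>v x) = 0"
proof -
  have "A \<bullet> (W *\<^sub>v x) = (\<Sum>q<2 * (m div 2). A $ q * (row W q \<bullet> x))"
    unfolding m_double[symmetric] using W by (auto simp: scalar_prod_def[of A] lessThan_atLeast0 intro!: sum.cong)
  also have "\<dots> = 0" unfolding sum_lessThan_double using sym by (intro sum.neutral) auto
  finally show ?thesis .
qed

lemma symmetric_init_sq: "A \<bullet> A = real m"
proof -
  have "A \<bullet> A = (\<Sum>q<2 * (m div 2). A $ q * A $ q)"
    unfolding m_double[symmetric] using A by (auto simp: scalar_prod_def lessThan_atLeast0)
  also have "\<dots> = (\<Sum>q<m div 2. 2)"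
    unfolding sum_lessThan_double using sym by (intro sum.cong) auto
  also have "\<dots> = real m" using m by (simp add: real_of_nat_div)
  finally show ?thesis .
qed

lemma symmetric_init_form:
  assumes iso: "\<forall>i<d. \<forall>j<d. (\<Sum>q<m div 2. W $$ (q, i) * W $$ (q, j)) =
                      (if i = j then real m / (2 * real d) else 0)"
    and x: "x \<in> carrier_vec d" and y: "y \<in> carrier_vec d"
  shows "(W *\<^sub>v x) \<bullet> (W *\<^sub>v y) = real m / real d * (x \<bullet> y)"
proof -
  let ?h = "m div 2"
  have "(W *\<^sub>v x) \<bullet> (W *\<^sub>v y) = (\<Sum>q<2 * ?h. (row W q \<bullet> x) * (row W q \<bullet> y))"
    unfolding m_double[symmetric] using W by (auto simp: scalar_prod_def[of "W *\<^sub>v x"] lessThan_atLeast0 intro!: sum.cong)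
  also have "\<dots> = (\<Sum>q<?h. 2 * ((row W q \<bullet> x) * (row W q \<bullet> y)))"
    unfolding sum_lessThan_double using sym by (intro sum.cong) auto
  also have "\<dots> = (\<Sum>q<?h. \<Sum>i<d. \<Sum>j<d. 2 * (x $ i * y $ j * (W $$ (q, i) * W $$ (q, j))))"
  proof (intro sum.cong refl)
    fix q assume "q \<in> {..<?h}"
    then have q: "q < m" by auto
    have r: "row W q \<bullet> z = (\<Sum>i<d. W $$ (q, i) * z $ i)" if "z \<in> carrier_vec d" for z
      using that W q by (simp add: scalar_prod_def lessThan_atLeast0)
    show "2 * ((row W q \<bullet> x) * (row W q \<bullet> y))
        = (\<Sum>i<d. \<Sum>j<d. 2 * (x $ i * y $ j * (W $$ (q, i) * W $$ (q, j))))"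
      unfolding r[OF x] r[OF y] sum_product by (simp add: sum_distrib_left mult_ac)
  qed
  also have "\<dots> = (\<Sum>i<d. \<Sum>j<d. \<Sum>q<?h. 2 * (x $ i * y $ j * (W $$ (q, i) * W $$ (q, j))))"
    unfolding sum.swap[of _ _ "{..<?h}"] ..
  also have "\<dots> = (\<Sum>i<d. \<Sum>j<d. 2 * (x $ i * y $ j) * (if i = j then real m / (2 * real d) else 0))"
    using iso by (intro sum.cong refl) (simp add: sum_distrib_left[symmetric] mult.assoc)
  also have "\<dots> = (\<Sum>i<d. 2 * (x $ i * y $ i) * (real m / (2 * real d)))"
    by (intro sum.cong refl) (simp add: if_distrib[of "\<lambda>x. _ * x"] cong: if_cong)
  also have "\<dots> = real m / real d * (x \<bullet> y)"
    using y by (simp add: scalar_prod_def sum_distrib_left lessThan_atLeast0 mult_ac)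
  finally show ?thesis .
qed

end

section \<open>Choice of the constants and assembly\<close>

lemma antitone_interval:
  fixes lam :: "nat \<Rightarrow> real"
  assumes step: "\<forall>i\<in>{1..<r}. lam i \<ge> lam (i + 1)" and ij: "1 \<le> i" "i \<le> j" "j \<le> r"
  shows "lam j \<le> lam i"
  using ij(2,3)
proof (induction j rule: dec_induct)
  case (step k)
  then have "lam (k + 1) \<le> lam k" using ij(1) assms(1) by auto
  then show ?case using step by simp
qed simp

lemma gd_carrier:
  assumes "X \<in> carrier_mat d n" "A0 \<in> carrier_vec m" "W0 \<in> carrier_mat m d"
  shows "fst (gd eta X Y A0 W0 t) \<in> carrier_vec m" "snd (gd eta X Y A0 W0 t) \<in> carrier_mat m d"
proof (induction t)
  case (Suc t)
  {
    case 1
    have "dim_row (snd (gd eta X Y A0 W0 t)) = m" using Suc(2) by simp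
    then show ?case by (auto simp: case_prod_beta Let_def intro!: carrier_vecI)
  next
    case 2
    have "dim_vec (fst (gd eta X Y A0 W0 t)) = m" using Suc(1) by simp
    then show ?case using assms(1) by (auto simp: case_prod_beta Let_def outer_def intro!: carrier_matI)
  }
qed (use assms in auto)

text \<open>\<open>K / eta\<close> turns the width assumption into
  \<open>K * \<mu> \<le> (l r)\<^sup>2\<close>. The entry \<open>40 / (1 - eta * c1)\<close> of
  \<open>K\<close> keeps overshooting factors contractive. The summands of \<open>C2\<close> serve,
  in order, the untouched top coordinate (\<open>small1\<close>), the chain case
  (\<open>small2\<close>), and the two comparisons with the residual size (\<open>small3\<close>,
  \<open>small4\<close>).\<close>

lemma sharpness_increases:
  fixes chi c1 eta \<epsilon> \<kappa> K C2 :: real and d n m r t :: nat and X W0 Wst :: "real mat"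
    and Y A0 Ast :: "real vec" and lam :: "nat \<Rightarrow> real" and v :: "nat \<Rightarrow> real vec"
  defines "K \<equiv> max 7680 (40 / (1 - eta * c1))"
    and "C2 \<equiv> 1 / c1 + eta * chi + eta\<^sup>2"
    and "A \<equiv> \<lambda>t. fst (gd eta X Y A0 W0 t)" and "W \<equiv> \<lambda>t. snd (gd eta X Y A0 W0 t)"
  assumes chi: "chi > 1" and c1: "c1 > 0" and eta: "eta > 0" and etac1: "eta * c1 < 1"
    and eps: "\<epsilon> > 0" and d: "d \<ge> 1" and n: "n \<ge> 1" and m: "even m"
    and X: "X \<in> carrier_mat d n" and Y: "Y \<in> carrier_vec n"
    and Y_sign: "\<forall>i<n. Y $ i = 1 \<or> Y $ i = -1"
    and Ast: "Ast \<in> carrier_vec m" and Wst: "Wst \<in> carrier_mat m d"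
    and Y_eq: "Y = (transpose_mat X * transpose_mat Wst) *\<^sub>v Ast"
    and A0: "A0 \<in> carrier_vec m" and W0: "W0 \<in> carrier_mat m d"
    and sym: "\<forall>q<m div 2. (A0 $ q = 1 \<or> A0 $ q = -1) \<and> A0 $ (q + m div 2) = - A0 $ q \<and>
                    row W0 (q + m div 2) = row W0 q"
    and iso: "\<forall>i<d. \<forall>j<d. (\<Sum>q<m div 2. W0 $$ (q, i) * W0 $$ (q, j)) =
                      (if i = j then real m / (2 * real d) else 0)"
    and r: "r \<ge> 1"
    and v: "\<forall>i\<in>{1..r}. v i \<in> carrier_vec n"
    and orth: "\<forall>i\<in>{1..r}. \<forall>j\<in>{1..r}. v i \<bullet> v j = (if i = j then 1 else 0)"
    and decomp: "\<forall>i<n. \<forall>j<n. (transpose_mat X * X) $$ (i, j) = (\<Sum>k\<in>{1..r}. lam k * v k $ i * v k $ j)"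
    and lam_mono: "\<forall>i\<in>{1..<r}. lam i \<ge> lam (i + 1)" and lam_r: "lam r > 0"
    and lam_chi: "\<forall>i\<in>{1..<r}. lam i \<le> chi * lam (i + 1)"
    and kap: "\<kappa> > 0" and Y_kap: "\<forall>i\<in>{1..r}. (Y \<bullet> v i) / sqrt (real n) \<ge> \<kappa>"
    and lam_1: "lam 1 = c1 * real n"
    and m_ge: "real m \<ge> K / eta * real n ^ 2 / lam r ^ 2"
    and n_ge: "real n \<ge> C2 * Max {lam r / \<kappa>^2, lam r ^ 2 / \<kappa>^2,
                           lam r ^ 2 / (\<kappa>^4 * \<epsilon>^2), lam r ^ 4 / (\<kappa>^4 * \<epsilon>^2)}"
    and t: "t \<ge> 1"
    and running: "\<forall>s\<le>t. \<not> (vnorm (resid X Y (A s) (W s)) ^ 2 \<le> 1 * \<epsilon>^2 \<or>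
                        lambda_max (gram_Mstar eta X Y (A s) (W s)) > 1 / eta)"
  shows "v 1 \<bullet> (gram_M X (A (t + 1)) (W (t + 1)) *\<^sub>v v 1) - v 1 \<bullet> (gram_M X (A t) (W t) *\<^sub>v v 1) > 0 \<and>
    spec_norm (gram_Gamma X (A t) (W t)) \<le> 40 / real m"
proof -
  note One_nat_def [simp del]
  have K7: "7680 \<le> K" and K40: "40 / (1 - eta * c1) \<le> K" by (auto simp: K_def)
  have K0: "0 < K" using K7 by simp
  have n0: "0 < real n" using n by simp
  have m0: "0 < real m"
  proof -
    have "0 < K / eta * real n ^ 2 / lam r ^ 2" using K0 eta n0 lam_r by simp
    then show ?thesis using m_ge by linarith
  qed
  have r1: "1 \<in> {1..r}" "r \<in> {1..r}" using r by auto
  define s where "s = transpose_mat Wst *\<^sub>v Ast"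
  have WT: "transpose_mat Wst \<in> carrier_mat d m" using Wst by simp
  have sc: "s \<in> carrier_vec d" using WT Ast by (simp add: s_def)
  have Ys: "Y = transpose_mat X *\<^sub>v s"
    unfolding Y_eq s_def using X by (intro assoc_mult_mat_vec[OF _ WT Ast]) simp
  have Ac: "A t \<in> carrier_vec m" and Wc: "W t \<in> carrier_mat m d" for t
    using gd_carrier[OF X A0 W0] by (auto simp: A_def W_def)
  interpret eigen_data X d n r lam v
    by unfold_locales (use X v orth decomp in auto)
  interpret S: net_state X d n r lam v Y s "A k" "W k" m eta for k
    by unfold_locales (use sc Ys Ac Wc m0 n d in auto)
  have dims: "dim_col X = n" "dim_row X = d" "dim_vec (A t) = m" for t using X Ac by auto
  have A_Suc: "A (Suc t) = S.A' t" and W_Suc: "W (Suc t) = S.W' t" for t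
    using dims unfolding S.A'_def S.W'_def S.c_def by (simp_all add: A_def W_def case_prod_beta Let_def)
  have A_0: "A 0 = A0" and W_0: "W 0 = W0" by (auto simp: A_def W_def)
  have F0: "net_F X (A 0) (W 0) \<bullet> x = 0" if "x \<in> carrier_vec n" for x
  proof -
    have "sqrt (real m) * (net_F X (A 0) (W 0) \<bullet> x) = 0"
      using S.net_F_v[OF Ac[of 0] Wc[of 0] that] symmetric_init_output[OF m A0 W0 sym]
      unfolding A_0 W_0 by simp
    then show ?thesis using m0 by simp
  qed
  define z where "z i = Y \<bullet> v i" for i
  define l where "l i = eta * lam i / real n" for i
  define Dc where "Dc t i = S.D t \<bullet> v i" for t i
  define H where "H t i j = eta * S.Gam t i j" for t i j
  define b where "b t = (A t \<bullet> A t) / real m" for t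
  define w where "w = 4 * (eta / real m) / real n"
  have Fv: "S.F t \<bullet> v i = Dc t i + z i" if "i \<in> {1..r}" for t i
    using S.F[of t] S.Y_carrier v that
    by (simp add: Dc_def z_def resid_def minus_scalar_prod_distrib[of _ n])
  have lam_anti: "lam j \<le> lam i" if "1 \<le> i" "i \<le> j" "j \<le> r" for i j
    by (rule antitone_interval[OF lam_mono that])
  have lam_pos: "0 < lam i" if "i \<in> {1..r}" for i using lam_anti[of i r] that lam_r by auto
  have l1: "l 1 = eta * c1" unfolding l_def lam_1 using n0 by simp
  have zsum: "(\<Sum>i\<in>{1..r}. (z i)\<^sup>2) = real n"
  proof -
    have "(\<Sum>i\<in>{1..r}. (z i)\<^sup>2) = Y \<bullet> Y"
      using Parseval[OF sc Ys Y] by (simp add: z_def power2_eq_square)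
    also have "\<dots> = (\<Sum>i<n. 1)" unfolding scalar_prod_self_eq_sum
      using Y Y_sign by (intro sum.cong) auto
    finally show ?thesis by simp
  qed
  have z_ge: "\<kappa> * sqrt (real n) \<le> z i" if "i \<in> {1..r}" for i
    using Y_kap that n0 by (auto simp: z_def field_simps)
  \<comment> \<open>A single coordinate of \<open>Y\<close> is at most \<open>sqrt n\<close>. This
    allows a power of \<open>\<kappa>\<close> to be dropped when the bounds on \<open>n\<close> are
    used below.\<close>
  have kap1: "\<kappa> \<le> 1"
  proof -
    have "(\<kappa> * sqrt (real n))\<^sup>2 \<le> (z 1)\<^sup>2" using z_ge[OF r1(1)] kap n0 by (intro power_mono) auto
    also have "\<dots> \<le> real n" unfolding zsum[symmetric] using r1 by (intro member_le_sum) auto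
    finally have "\<kappa>\<^sup>2 * real n \<le> 1 * real n" by (simp add: power_mult_distrib)
    then have "\<kappa>\<^sup>2 \<le> 1\<^sup>2" using n0 by simp
    then show ?thesis by (rule power2_le_imp_le) simp
  qed
  have C2: "1 / c1 \<le> C2" "eta * chi \<le> C2" "eta\<^sup>2 \<le> C2" "0 \<le> C2"
    using c1 eta chi by (auto simp: C2_def)
  define M where "M = Max {lam r / \<kappa>^2, lam r ^ 2 / \<kappa>^2,
                           lam r ^ 2 / (\<kappa>^4 * \<epsilon>^2), lam r ^ 4 / (\<kappa>^4 * \<epsilon>^2)}"
  have M: "lam r / \<kappa>^2 \<le> M" "lam r ^ 2 / (\<kappa>^4 * \<epsilon>^2) \<le> M" unfolding M_def by (auto intro: Max_ge)
  have n_kap: "C2 * lam r \<le> \<kappa>\<^sup>2 * real n"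
  proof -
    have "C2 * (lam r / \<kappa>^2) \<le> real n"
      using mult_left_mono[OF M(1) C2(4)] n_ge by (simp add: M_def)
    then show ?thesis using kap by (simp add: field_simps)
  qed
  have eps_kap: "eta * lam r \<le> \<kappa> * \<epsilon> * sqrt (real n)"
  proof -
    have "C2 * (lam r ^ 2 / (\<kappa>^4 * \<epsilon>^2)) \<le> real n"
      using mult_left_mono[OF M(2) C2(4)] n_ge by (simp add: M_def)
    then have "C2 * lam r ^ 2 \<le> \<kappa>^4 * \<epsilon>^2 * real n" using kap eps by (simp add: field_simps)
    moreover have "eta\<^sup>2 * lam r ^ 2 \<le> C2 * lam r ^ 2" using C2(3) by (intro mult_right_mono) auto
    ultimately have "(eta * lam r)\<^sup>2 \<le> (\<kappa>\<^sup>2 * \<epsilon> * sqrt (real n))\<^sup>2"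
      by (simp add: power_mult_distrib power_mult[symmetric])
    then have "eta * lam r \<le> \<kappa>\<^sup>2 * \<epsilon> * sqrt (real n)"
      by (rule power2_le_imp_le) (use eps in simp)
    also have "\<dots> \<le> \<kappa> * \<epsilon> * sqrt (real n)"
      using kap kap1 eps by (intro mult_right_mono) (auto simp: power2_eq_square mult_le_cancel_left1)
    finally show ?thesis .
  qed
  have eps_n: "eta * lam r \<le> \<epsilon> * sqrt (real n)"
  proof -
    have "\<kappa> * (\<epsilon> * sqrt (real n)) \<le> 1 * (\<epsilon> * sqrt (real n))"
      using kap1 eps by (intro mult_right_mono) auto
    then show ?thesis using eps_kap by simp
  qed
  have el: "0 < eta * lam r" using eta lam_r by simp
  \<comment> \<open>All four smallness requirements are checked against this common bound; 480 /
    7680 is 1 / 16.\<close>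
  have q480: "480 * l r * real n / K \<le> eta * lam r / 16"
  proof -
    have "480 * l r * real n / K = 480 * (eta * lam r) / K" using n0 by (simp add: l_def)
    also have "\<dots> \<le> 480 * (eta * lam r) / 7680" using K7 el by (intro divide_left_mono) auto
    finally show ?thesis by simp
  qed
  have zeta2: "(\<kappa> * sqrt (real n))\<^sup>2 = \<kappa>\<^sup>2 * real n" by (simp add: power_mult_distrib)
  have run: "\<epsilon>\<^sup>2 < vnorm (S.D t') ^ 2" "lambda_max (gram_Mstar eta X Y (A t') (W t')) \<le> 1 / eta"
    if "t' \<le> t" for t' using running[rule_format, OF that] by (simp_all add: not_le not_less)
  \<comment> \<open>The horizon is the given time \<open>t\<close>; (A2) makes
    \<open>\<kappa> * sqrt n\<close> the lower bound on the label coordinates, and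
    \<open>\<epsilon>\<close> is the residual threshold.\<close>
  interpret C: gd_coords r l z Dc H b S.gam "real n" "eta / real m" K chi "\<kappa> * sqrt (real n)" \<epsilon> w t
  proof
    show "1 \<le> r" "0 < real n" "0 < eta / real m" "7680 \<le> K" "l 1 < 1" "1 < chi" "0 < \<kappa> * sqrt (real n)"
      "(\<Sum>i\<in>{1..r}. (z i)\<^sup>2) = real n" "w = 4 * (eta / real m) / real n" "0 < \<epsilon>"
      using r n0 eta m0 K7 l1 etac1 chi kap zsum w_def eps by auto
    show "40 \<le> K * (1 - l 1)" using K40 etac1 by (simp add: l1 field_simps)
    show "K * (eta / real m) \<le> (l r)\<^sup>2"
      using m_ge m0 n0 eta lam_r by (simp add: l_def field_simps power2_eq_square)
    show "0 < l i" if "i \<in> {1..r}" for i using lam_pos[OF that] eta n0 by (simp add: l_def)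
    show "l i \<le> l 1" if "i \<in> {1..r}" for i
      unfolding l_def using lam_anti[of 1 i] that eta by (intro divide_right_mono mult_left_mono) auto
    show "l r \<le> l i" if "i \<in> {1..r}" for i
      unfolding l_def using lam_anti[of i r] that eta by (intro divide_right_mono mult_left_mono) auto
    show "l i \<le> chi * l (i + 1)" if i: "i \<in> {1..<r}" for i
    proof -
      have "eta * lam i / real n \<le> eta * (chi * lam (i + 1)) / real n"
        using lam_chi i eta by (intro divide_right_mono mult_left_mono) auto
      then show ?thesis by (simp add: l_def mult_ac)
    qed
    show "\<kappa> * sqrt (real n) \<le> z i" if "i \<in> {1..r}" for i by (rule z_ge[OF that])
    show "Dc 0 i = - z i" if "i \<in> {1..r}" for i using Fv[OF that, of 0] F0[of "v i"] v that by simp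
    show "H 0 i j = 0" if "i \<in> {1..r}" "j \<in> {1..r}" for i j
    proof -
      have u: "X *\<^sub>v v i \<in> carrier_vec d" "X *\<^sub>v v j \<in> carrier_vec d" using Xv that by auto
      have "S.G 0 i j = real m / real d * ((X *\<^sub>v v i) \<bullet> (X *\<^sub>v v j))"
        unfolding S.G_def unfolding W_0 by (rule symmetric_init_form[OF m A0 W0 sym iso u])
      also have "(X *\<^sub>v v i) \<bullet> (X *\<^sub>v v j) = (if i = j then lam i else 0)"
        using Xx_Xv[of j "v i"] orth v that by simp
      finally show ?thesis by (simp add: H_def S.Gam_eq[OF that])
    qed
    show "b 0 = 1" using symmetric_init_sq[OF m A0 W0 sym] m0 by (simp add: b_def A_0)
    show "Dc (Suc t') i = (1 - S.gam t' * l i) * Dc t' i - (\<Sum>j\<in>{1..r}. H t' i j * Dc t' j)"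
      if "i \<in> {1..r}" for t' i
      using S.D_step[OF that, of t'] unfolding Dc_def H_def l_def A_Suc W_Suc .
    show "H (Suc t') i j = H t' i j - w * ((Dc t' i + z i) * (l j * Dc t' j) + (l i * Dc t' i) * (Dc t' j + z j))
          + 2 * w * b t' * (l i * Dc t' i) * (l j * Dc t' j)"
      if i: "i \<in> {1..r}" and j: "j \<in> {1..r}" for t' i j
      unfolding H_def S.Gam_eq[OF i j, of "Suc t'"] unfolding S.G_def[of "Suc t'"]
      unfolding A_Suc W_Suc l_def w_def b_def
      by (rule S.Gam_step[OF i j, of t', unfolded Fv[OF i] Fv[OF j], folded Dc_def])
    have FD: "(\<Sum>i\<in>{1..r}. (S.F t' \<bullet> v i) * (S.D t' \<bullet> v i)) = (\<Sum>i\<in>{1..r}. (Dc t' i + z i) * Dc t' i)" for t'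
      by (intro sum.cong refl) (use Fv in \<open>simp add: Dc_def\<close>)
    show "b t' - w * (\<Sum>i\<in>{1..r}. (Dc t' i + z i) * Dc t' i) \<le> b (Suc t')" for t'
    proof -
      let ?S = "\<Sum>i\<in>{1..r}. (Dc t' i + z i) * Dc t' i"
      have "0 \<le> S.c * S.c * (((W t' * X) *\<^sub>v S.D t') \<bullet> ((W t' * X) *\<^sub>v S.D t'))"
        using scalar_prod_self_nonneg by simp
      then have "A t' \<bullet> A t' - 4 * eta / real n * ?S \<le> A (Suc t') \<bullet> A (Suc t')"
        unfolding A_Suc S.A'_sq FD by simp
      then have "(A t' \<bullet> A t' - 4 * eta / real n * ?S) / real m \<le> b (Suc t')"
        unfolding b_def by (intro divide_right_mono) auto
      then show ?thesis by (simp add: b_def w_def diff_divide_distrib mult_ac)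
    qed
    show "2 * b t' - w * (\<Sum>i\<in>{1..r}. (Dc t' i + z i) * Dc t' i) \<le> S.gam t'" for t'
      unfolding S.gam_def FD b_def w_def by simp
    show "S.gam t' * l 1 + H t' 1 1 \<le> 1" if t': "t' \<le> t" for t'
    proof -
      have "v 1 \<bullet> (gram_Mstar eta X Y (A t') (W t') *\<^sub>v v 1) \<le> 1 / eta"
        using S.Mstar_le_lambda_max[OF r1(1), of t'] run(2)[OF t'] by linarith
      then have "eta * (v 1 \<bullet> (gram_Mstar eta X Y (A t') (W t') *\<^sub>v v 1)) \<le> eta * (1 / eta)"
        using eta by (intro mult_left_mono) auto
      then show ?thesis using eta unfolding S.Mstar_v_gam[OF r1(1)] l_def H_def by simp
    qed
    show "\<epsilon> \<le> L2_set (Dc t') {1..r}" if t': "t' \<le> t" for t'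
    proof -
      have "L2_set (Dc t') {1..r} = vnorm (S.D t')"
        using S.D_Parseval[OF S.D, of t' t'] by (simp add: L2_set_def Dc_def vnorm_def power2_eq_square)
      then have "\<epsilon>\<^sup>2 \<le> (L2_set (Dc t') {1..r})\<^sup>2" using run(1)[OF t'] by simp
      then show ?thesis by (rule power2_le_imp_le) (simp add: L2_set_nonneg)
    qed
    show "480 * l r * real n / K < (\<kappa> * sqrt (real n))\<^sup>2 / 2 * l 1"
    proof -
      have "lam r \<le> c1 * (C2 * lam r)"
        using mult_right_mono[OF C2(1), of "c1 * lam r"] c1 lam_r by (simp add: mult_ac)
      also have "\<dots> \<le> c1 * (\<kappa>\<^sup>2 * real n)" using n_kap c1 by (intro mult_left_mono) auto
      finally have "eta * lam r \<le> eta * (c1 * (\<kappa>\<^sup>2 * real n))" using eta by (intro mult_left_mono) auto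
      then have "eta * lam r / 2 \<le> (\<kappa> * sqrt (real n))\<^sup>2 / 2 * l 1"
        unfolding zeta2 l1 by (simp add: mult_ac)
      then show ?thesis using q480 el by linarith
    qed
    show "480 * l r * real n / K < (\<kappa> * sqrt (real n))\<^sup>2 / (4 * chi)"
    proof -
      have "eta * chi * lam r \<le> C2 * lam r" using C2(2) lam_r by (intro mult_right_mono) auto
      also note n_kap
      finally have "eta * chi * lam r / (4 * chi) \<le> (\<kappa> * sqrt (real n))\<^sup>2 / (4 * chi)"
        unfolding zeta2 using chi by (intro divide_right_mono) auto
      then have "eta * lam r / 4 \<le> (\<kappa> * sqrt (real n))\<^sup>2 / (4 * chi)" using chi by (simp add: mult_ac)
      then show ?thesis using q480 el by linarith
    qed
    show "80 * l r * sqrt (real n) / K \<le> \<epsilon> / 2"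
    proof -
      have "80 * l r * sqrt (real n) / K = (480 * l r * real n / K) / (6 * sqrt (real n))"
        using n0 K0 real_sqrt_mult_self[of "real n"] by (simp add: divide_simps)
      also have "\<dots> \<le> (\<epsilon> * sqrt (real n)) / (6 * sqrt (real n))"
        using q480 eps_n el n0 by (intro divide_right_mono) auto
      also have "\<dots> \<le> \<epsilon> / 2" using n0 eps by simp
      finally show ?thesis .
    qed
    show "480 * l r * real n / K < \<kappa> * sqrt (real n) * \<epsilon> / 4"
    proof -
      have "eta * lam r / 4 \<le> \<kappa> * sqrt (real n) * \<epsilon> / 4" using eps_kap by (simp add: mult_ac)
      then show ?thesis using q480 el by linarith
    qed
  qed
  have "v 1 \<bullet> (gram_M X (A t) (W t) *\<^sub>v v 1) < v 1 \<bullet> (gram_M X (A (Suc t)) (W (Suc t)) *\<^sub>v v 1)"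
    unfolding S.M_v[OF r1(1)] S.G_def[of "Suc t"] unfolding A_Suc W_Suc
  proof (rule S.sharpness_step[OF r1(1) eta lam_pos[OF r1(1)]])
    have "(\<Sum>j\<in>{1..r}. (S.F t \<bullet> v j) * (S.D t \<bullet> v j)) + (S.F t \<bullet> v 1) * (S.D t \<bullet> v 1)
      = (\<Sum>j\<in>{1..r}. C.F t j * Dc t j) + C.F t 1 * Dc t 1"
      unfolding C.F_def Fv[OF r1(1)] Dc_def[symmetric]
      by (intro arg_cong2[of _ _ _ _ "(+)"] sum.cong refl) (use Fv in auto)
    then show "(\<Sum>j\<in>{1..r}. (S.F t \<bullet> v j) * (S.D t \<bullet> v j)) + (S.F t \<bullet> v 1) * (S.D t \<bullet> v 1) < 0"
      using C.conclusion(1)[OF t order_refl] by simp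
  qed
  moreover have "spec_norm (gram_Gamma X (A t) (W t)) \<le> 40 / real m"
  proof (rule S.spec_norm_Gamma_le)
    fix y x
    have "eta * (\<Sum>i\<in>{1..r}. y i * (\<Sum>j\<in>{1..r}. S.Gam t i j * x j)) = C.bil t y x"
      by (simp add: C.bil_def H_def sum_distrib_left mult_ac)
    then have "eta * \<bar>\<Sum>i\<in>{1..r}. y i * (\<Sum>j\<in>{1..r}. S.Gam t i j * x j)\<bar> = \<bar>C.bil t y x\<bar>"
      using eta by (metis abs_mult abs_of_pos)
    also have "\<dots> \<le> eta * (40 / real m * (L2_set y {1..r} * L2_set x {1..r}))"
      using C.conclusion(2)[OF t order_refl, of y x] by (simp add: mult_ac)
    finally show "\<bar>\<Sum>i\<in>{1..r}. y i * (\<Sum>j\<in>{1..r}. S.Gam t i j * x j)\<bar>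
        \<le> 40 / real m * (L2_set y {1..r} * L2_set x {1..r})"
      using eta by (simp only: mult_le_cancel_left_pos)
  qed simp
  ultimately show ?thesis by (simp only: Suc_eq_plus1 diff_gt_0_iff_gt)
qed

text \<open>The condition that \<open>stop\<close> fails at all \<open>s \<le> t\<close> expresses
  \<open>t < t\<^sub>0\<close> without assuming that a stopping time exists. The constants are
  chosen before \<open>\<epsilon>\<close>, hence uniform in it.\<close>

theorem theorem4p1:
  fixes chi c1 eta :: real
  assumes chi: "chi > 1" and c1: "c1 > 0" and eta: "eta > 0" and etac1: "eta * c1 < 1"
  shows "\<exists>C1 C2 C3 :: real. C1 > 0 \<and> C2 > 0 \<and> C3 > 0 \<and>
    (\<forall>(\<epsilon>::real) (d::nat) (n::nat) (m::nat) (X::real mat) (Y::real vec)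
       (Ast::real vec) (Wst::real mat) (A0::real vec) (W0::real mat)
       (r::nat) (lam::nat \<Rightarrow> real) (v::nat \<Rightarrow> real vec) (\<kappa>::real).
      \<epsilon> > 0 \<and> d \<ge> 1 \<and> n \<ge> 1 \<and> even m \<and>
      X \<in> carrier_mat d n \<and> Y \<in> carrier_vec n \<and> (\<forall>i<n. Y $ i = 1 \<or> Y $ i = -1) \<and>
      Ast \<in> carrier_vec m \<and> Wst \<in> carrier_mat m d \<and>
      Y = (transpose_mat X * transpose_mat Wst) *\<^sub>v Ast \<and>
      A0 \<in> carrier_vec m \<and> W0 \<in> carrier_mat m d \<and>
      (\<forall>q<m div 2. (A0 $ q = 1 \<or> A0 $ q = -1) \<and> A0 $ (q + m div 2) = - A0 $ q \<and>
                    row W0 (q + m div 2) = row W0 q) \<and>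
      (\<forall>i<d. \<forall>j<d. (\<Sum>q<m div 2. W0 $$ (q, i) * W0 $$ (q, j)) =
                      (if i = j then real m / (2 * real d) else 0)) \<and>
      \<comment> \<open>eigendecomposition of X^T X of rank r, indices 1..r\<close>
      r \<ge> 1 \<and>
      (\<forall>i\<in>{1..r}. v i \<in> carrier_vec n) \<and>
      (\<forall>i\<in>{1..r}. \<forall>j\<in>{1..r}. v i \<bullet> v j = (if i = j then 1 else 0)) \<and>
      (\<forall>i<n. \<forall>j<n. (transpose_mat X * X) $$ (i, j) = (\<Sum>k\<in>{1..r}. lam k * v k $ i * v k $ j)) \<and>
      (\<forall>i\<in>{1..<r}. lam i \<ge> lam (i + 1)) \<and> lam r > 0 \<and>
      \<comment> \<open>(A1)\<close>
      (\<forall>i\<in>{1..<r}. lam i \<le> chi * lam (i + 1)) \<and> (r \<ge> 2 \<longrightarrow> lam 1 \<ge> 2 * lam 2) \<and>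
      \<comment> \<open>(A2)\<close>
      \<kappa> > 0 \<and> (\<forall>i\<in>{1..r}. (Y \<bullet> v i) / sqrt (real n) \<ge> \<kappa>) \<and>
      lam 1 = c1 * real n \<and>
      real m \<ge> C1 * real n ^ 2 / lam r ^ 2 \<and>
      real n \<ge> C2 * Max {lam r / \<kappa>^2, lam r ^ 2 / \<kappa>^2,
                           lam r ^ 2 / (\<kappa>^4 * \<epsilon>^2), lam r ^ 4 / (\<kappa>^4 * \<epsilon>^2)}
      \<longrightarrow>
      (let A = (\<lambda>t. fst (gd eta X Y A0 W0 t)); W = (\<lambda>t. snd (gd eta X Y A0 W0 t));
           stop = (\<lambda>t. vnorm (resid X Y (A t) (W t)) ^ 2 \<le> C3 * \<epsilon>^2 \<or>
                        lambda_max (gram_Mstar eta X Y (A t) (W t)) > 1 / eta);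
           Lam = (\<lambda>t. v 1 \<bullet> (gram_M X (A t) (W t) *\<^sub>v v 1))
       in \<forall>t\<ge>1. (\<forall>s\<le>t. \<not> stop s) \<longrightarrow>
            Lam (t + 1) - Lam t > 0 \<and>
            spec_norm (gram_Gamma X (A t) (W t)) \<le> 40 / real m))"
proof -
  define K where "K = max 7680 (40 / (1 - eta * c1))"
  define C2 where "C2 = 1 / c1 + eta * chi + eta\<^sup>2"
  have K0: "K / eta > 0" using eta by (simp add: K_def less_max_iff_disj)
  have C20: "C2 > 0" using c1 eta chi by (simp add: C2_def add_pos_pos)
  have C30: "(1 :: real) > 0" by simp
  show ?thesis
  \<comment> \<open>All witnesses are functions of \<open>chi\<close>, \<open>c1\<close> and
    \<open>eta * c1\<close>, since \<open>eta\<close> is the quotient of the last two.\<close>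
  proof (rule exI[of _ "K / eta"], rule exI[of _ C2], rule exI[of _ "1 :: real"],
      rule conjI, rule K0, rule conjI, rule C20, rule conjI, rule C30,
      intro allI impI, goal_cases)
    case (1 \<epsilon> d n m X Y Ast Wst A0 W0 r lam v \<kappa>)
    from 1 show ?case unfolding Let_def
      by (elim conjE, intro allI impI)
        (rule sharpness_increases[OF chi c1 eta etac1, where \<epsilon> = \<epsilon> and \<kappa> = \<kappa> and d = d
            and n = n and m = m and X = X and Y = Y and Ast = Ast and Wst = Wst and ?A0.0 = A0
            and ?W0.0 = W0 and r = r and lam = lam and v = v, folded K_def C2_def]; assumption)
  qed
qed

end
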